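(* Let $k,q\ge1$, $p\ge0$, $T\ge q$ be integers and let $\boldsymbol\theta(L)=1+\theta_1L+\cdots+\theta_qL^q=\prod_{l=1}^q(1-\lambda_lL)$ be a real polynomial with all $\lambda_l\in\mathbb C\setminus\{0\}$. Let $\{i_1,\dots,i_r\}\subset\{1,\dots,q\}$ be a set of distinct indices such that the multiset $\{\lambda_{i_1},\dots,\lambda_{i_r}\}$ is closed under complex conjugation. Let $\Omega$ be a positive definite $k\times k$ matrix, put $c=\lambda_{i_1}\cdots\lambda_{i_r}$ and $$\boldsymbol\theta_{IR}(L)=\prod_{i\notin\{i_1,\dots,i_r\}}(1-\lambda_iL)\prod_{i\in\{i_1,\dots,i_r\}}(1-\lambda_i^{-1}L),\qquad \Omega_{IR}=c^2\,\Omega.$$ Then, with the notation of the context (in particular data $X_1,\dots,X_{T+p}$ for which $\mathbf X_{\mathrm{lag}}=(\mathbf 1\;\; L\mathbf X\;\cdots\;L^p\mathbf X)$ has full column rank, and, for the statements on $\bar{\mathscr L}$, $\Omega_{opt}(\boldsymbol\theta)$ is positive definite): (a) $g(z;\boldsymbol\theta_{IR};\Omega_{IR})=g(z;\boldsymbol\theta;\Omega)$; (b) $\Sigma_{IR;T}:=\Theta_{IR;T}\,K(\boldsymbol\theta_{IR},T)^{-1}\,\Theta_{IR;T}'=c^{-2}\,\Sigma_T$, where $\Theta_{IR;T}$ is the matrix $\Theta_T$ formed from $\boldsymbol\theta_{IR}$ and $\Sigma_T=\Theta_TK(\boldsymbol\theta,T)^{-1}\Theta_T'$; (c) $\det\bar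 K(\boldsymbol\theta_{IR})=c^{-2T}\det\bar K(\boldsymbol\theta)$; (d) $\begin{pmatrix}\mu\\ \Phi\end{pmatrix}_{opt}(\boldsymbol\theta_{IR})=\begin{pmatrix}\mu\\ \Phi\end{pmatrix}_{opt}(\boldsymbol\theta)$; (e) $\Omega_{opt}(\boldsymbol\theta_{IR})=c^{2}\,\Omega_{opt}(\boldsymbol\theta)$; (f) $\mathscr L(\boldsymbol\theta_{IR},\mu,\Phi,\Omega_{IR})=\mathscr L(\boldsymbol\theta,\mu,\Phi,\Omega)$ for all $\mu\in\mathbb R^{1\times k}$ and $\Phi=(\Phi_1,\dots,\Phi_p)$, $\Phi_i\in\mathbb R^{k\times k}$; (g) $\bar{\mathscr L}(\boldsymbol\theta_{IR})=\bar{\mathscr L}(\boldsymbol\theta)$; (h) if $\lambda_1,\dots,\lambda_q$ are pairwise distinct, and $J[IR]$ denotes the $q\times q$ Jacobian matrix at $\boldsymbol\theta$ of the (locally defined) map $IR:\boldsymbol\theta\mapsto\boldsymbol\theta_{IR}$ on coefficient space $\mathbb R^q$, then, with gradients as row vectors, $\nabla\bar{\mathscr L}(\boldsymbol\theta)=\nabla\bar{\mathscr L}(\boldsymbol\theta_{IR})\,J[IR]$.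
   Context: A prime denotes transpose. We identify the polynomial $\boldsymbol\theta(L)=1+\theta_1L+\cdots+\theta_qL^q$ with its coefficient vector $\boldsymbol\theta=(\theta_1,\dots,\theta_q)\in\mathbb R^q$; $\theta_0=1$. $\Theta_T$: $T\times T$ lower triangular Toeplitz matrix with $(i,j)$ entry $\theta_{i-j}$ if $0\le i-j\le q$, else $0$. $\Theta_*$: $q\times q$ upper triangular matrix with $(i,j)$ entry $\theta_{q-(j-i)}$ if $j\ge i$, else $0$. $\Theta_{*;T-q}$: the $T\times q$ matrix with $\Theta_*$ on top of a zero block. $\lambda=\Theta_T^{-1}\Theta_{*;T-q}$ (a matrix, not to be confused with the scalars $\lambda_l$), $\bar K(\boldsymbol\theta)=\lambda'\lambda+I_q$, $K=K(\boldsymbol\theta,T)=I_T-\lambda\bar K^{-1}\lambda'$. $\gamma_l=\sum_{m=0}^{q-l}\theta_m\theta_{m+l}$ for $0\le l\le q$, $\gamma_l=0$ for $l>q$, $\gamma_{-l}=\gamma_l$. The autocovariance-generating function is $g(z;\boldsymbol\theta;\Omega)=\big(\sum_{i=-\infty}^{\infty}\gamma_iz^i\big)\Omega$. Data are row vectors $X_1,\dots,X_{T+p}\in\mathbb R^{1\times k}$; $L^i\mathbf X$ ($0\le i\le p$, $\mathbf X=L^0\mathbf X$) is the $T\times k$ matrix with rows $X_{p-i+1},\dots,X_{T+p-i}$; $\mathbf 1$ is the all-ones column of length $T$; $\mathbf Z=\mathbf X-\mathbf 1\mu-(L\mathbf X)\Phi_1-\cdots-(L^p\mathbf X)\Phi_p$;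 $\mathbf X_\theta=\Theta_T^{-1}\mathbf X$; $\mathbf X_{\theta,\mathrm{lag}}=\Theta_T^{-1}(\mathbf 1\;\;L\mathbf X\;\cdots\;L^p\mathbf X)$. $\begin{pmatrix}\mu\\ \Phi\end{pmatrix}_{opt}(\boldsymbol\theta)=(\mathbf X_{\theta,\mathrm{lag}}'K\mathbf X_{\theta,\mathrm{lag}})^{-1}\mathbf X_{\theta,\mathrm{lag}}'K\mathbf X_\theta$, $\Omega_{opt}(\boldsymbol\theta)=\frac1T[\mathbf X_\theta'K\mathbf X_\theta-\mathbf X_\theta'K\mathbf X_{\theta,\mathrm{lag}}(\mathbf X_{\theta,\mathrm{lag}}'K\mathbf X_{\theta,\mathrm{lag}})^{-1}\mathbf X_{\theta,\mathrm{lag}}'K\mathbf X_\theta]$. Conditional log-likelihood functions: $\mathscr L(\boldsymbol\theta,\mu,\Phi,\Omega)=-\frac{Tk}2\log(2\pi)-\frac T2\log\det\Omega-\frac k2\log\det(\lambda'\lambda+I_q)-\frac12\operatorname{Tr}(\mathbf Z'(\Theta_T^{-1})'K\Theta_T^{-1}\mathbf Z\Omega^{-1})$, $\bar{\mathscr L}(\boldsymbol\theta)=-\frac{Tk}2\log(2\pi)-\frac T2\log\det\Omega_{opt}(\boldsymbol\theta)-\frac k2\log\det(\lambda'\lambda+I_q)-\frac{Tk}2$. The map $IR$ on coefficient space: near a $\boldsymbol\theta$ with pairwise distinct $\lambda_l$, the $\lambda_l$ are locally smooth functions of the coefficients (a continuous ordering is chosen); $IR$ sends the coefficient vector to that of the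 polynomial obtained by replacing $\lambda_{i_1},\dots,\lambda_{i_r}$ by their inverses. *)

theory Defs
  imports
    "HOL-Analysis.Analysis"
    "HOL-Computational_Algebra.Polynomial"
    "Jordan_Normal_Form.DL_Rank"
    "Jordan_Normal_Form.Gauss_Jordan_Elimination"
begin

unbundle no vec_syntax
unbundle no inner_syntax
hide_const (open) Finite_Cartesian_Product.vec Finite_Cartesian_Product.mat Determinants.det

text \<open>
  The order q is the cardinality of the index type; coefficient space is thus a Euclidean space, on
  which gradients and Jacobians are those of HOL-Analysis. All other matrices, whose dimensions
  are natural numbers, are matrices with explicit carriers and are indexed from 0.
\<close>

section \<open>Matrices\<close>

definition inv_mat :: "real mat \<Rightarrow> real mat" where
  "inv_mat A = the (mat_inverse A)"

definition mat_trace :: "real mat \<Rightarrow> real" where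
  "mat_trace A = (\<Sum>i<dim_row A. A $$ (i, i))"

definition positive_definite :: "nat \<Rightarrow> real mat \<Rightarrow> bool" where
  "positive_definite n A \<longleftrightarrow> A \<in> carrier_mat n n \<and> A\<^sup>T = A \<and>
     (\<forall>v \<in> carrier_vec n. v \<noteq> 0\<^sub>v n \<longrightarrow> v \<bullet> (A *\<^sub>v v) > 0)"

section \<open>Moving-average polynomials\<close>

text \<open>The coefficient \<open>\<theta>\<^sub>i\<close> for \<open>1 \<le> i \<le> q\<close> is the component at the i-th smallest element of the
  index type; it is extended by \<open>\<theta>\<^sub>0 = 1\<close> and by 0 beyond q.\<close>

definition ma_coeff :: "real ^ 'q::{finite,linorder} \<Rightarrow> nat \<Rightarrow> real" where
  "ma_coeff \<theta> i =
     (if i = 0 then 1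
      else if i \<le> CARD('q) then vec_nth \<theta> (sorted_list_of_set (UNIV :: 'q set) ! (i - 1))
      else 0)"

definition ma_poly :: "real ^ 'q::{finite,linorder} \<Rightarrow> complex poly" where
  "ma_poly \<theta> = (\<Sum>i\<le>CARD('q). monom (complex_of_real (ma_coeff \<theta> i)) i)"

definition factored_poly :: "complex ^ 'q::{finite,linorder} \<Rightarrow> complex poly" where
  "factored_poly \<Lambda> = (\<Prod>l\<in>UNIV. [:1, - vec_nth \<Lambda> l:])"

definition inverted_poly ::
  "complex ^ 'q::{finite,linorder} \<Rightarrow> 'q::{finite,linorder} set \<Rightarrow> complex poly" where
  "inverted_poly \<Lambda> S =
     (\<Prod>l\<in>- S. [:1, - vec_nth \<Lambda> l:]) * (\<Prod>l\<in>S. [:1, - inverse (vec_nth \<Lambda> l):])"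

text \<open>\<open>F\<close> is a local version of the map \<open>IR\<close> on the neighbourhood \<open>U\<close> of \<open>\<theta>\<close>, obtained from a
  continuous choice \<open>\<Lambda>\<close> of the \<open>\<lambda>\<^sub>l\<close> as functions of the coefficients, with \<open>\<Lambda> \<theta> = \<lambda>\<close>.\<close>

definition local_IR ::
  "real ^ 'q::{finite,linorder} \<Rightarrow> complex ^ 'q::{finite,linorder} \<Rightarrow> 'q set \<Rightarrow> (real ^ 'q::{finite,linorder}) set
   \<Rightarrow> (real ^ 'q::{finite,linorder} \<Rightarrow> real ^ 'q::{finite,linorder}) \<Rightarrow> bool" where
  "local_IR \<theta> lam S U F \<longleftrightarrow>
     open U \<and> \<theta> \<in> U \<and>
     (\<exists>\<Lambda> :: real ^ 'q::{finite,linorder} \<Rightarrow> complex ^ 'q::{finite,linorder}.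
        continuous_on U \<Lambda> \<and> \<Lambda> \<theta> = lam \<and>
        (\<forall>\<eta>\<in>U. (\<forall>l. vec_nth (\<Lambda> \<eta>) l \<noteq> 0) \<and>
               ma_poly \<eta> = factored_poly (\<Lambda> \<eta>) \<and>
               ma_poly (F \<eta>) = inverted_poly (\<Lambda> \<eta>) S))"

section \<open>Autocovariances\<close>

definition acov :: "real ^ 'q::{finite,linorder} \<Rightarrow> int \<Rightarrow> real" where
  "acov \<theta> l =
     (if nat \<bar>l\<bar> \<le> CARD('q)
      then \<Sum>m\<le>CARD('q) - nat \<bar>l\<bar>. ma_coeff \<theta> m * ma_coeff \<theta> (m + nat \<bar>l\<bar>)
      else 0)"

definition acov_gf :: "complex \<Rightarrow> real ^ 'q::{finite,linorder} \<Rightarrow> real mat \<Rightarrow> complex mat" where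
  "acov_gf z \<theta> \<Omega> =
     (\<Sum>\<^sub>\<infinity>i\<in>UNIV. complex_of_real (acov \<theta> i) * z powi i) \<cdot>\<^sub>m map_mat complex_of_real \<Omega>"

section \<open>The matrices attached to a moving-average polynomial\<close>

definition Theta :: "nat \<Rightarrow> real ^ 'q::{finite,linorder} \<Rightarrow> real mat" where
  "Theta T \<theta> = mat T T (\<lambda>(i, j).
     if j \<le> i \<and> i - j \<le> CARD('q) then ma_coeff \<theta> (i - j) else 0)"

definition Theta_star :: "real ^ 'q::{finite,linorder} \<Rightarrow> real mat" where
  "Theta_star \<theta> = mat CARD('q) CARD('q) (\<lambda>(i, j).
     if i \<le> j then ma_coeff \<theta> (CARD('q) - (j - i)) else 0)"

definition Theta_star_ext :: "nat \<Rightarrow> real ^ 'q::{finite,linorder} \<Rightarrow> real mat" where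
  "Theta_star_ext T \<theta> = Theta_star \<theta> @\<^sub>r 0\<^sub>m (T - CARD('q)) CARD('q)"

definition lambda_mat :: "nat \<Rightarrow> real ^ 'q::{finite,linorder} \<Rightarrow> real mat" where
  "lambda_mat T \<theta> = inv_mat (Theta T \<theta>) * Theta_star_ext T \<theta>"

definition Kbar :: "nat \<Rightarrow> real ^ 'q::{finite,linorder} \<Rightarrow> real mat" where
  "Kbar T \<theta> = (lambda_mat T \<theta>)\<^sup>T * lambda_mat T \<theta> + 1\<^sub>m CARD('q)"

definition Kmat :: "nat \<Rightarrow> real ^ 'q::{finite,linorder} \<Rightarrow> real mat" where
  "Kmat T \<theta> = 1\<^sub>m T - lambda_mat T \<theta> * inv_mat (Kbar T \<theta>) * (lambda_mat T \<theta>)\<^sup>T"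

definition Sigma_mat :: "nat \<Rightarrow> real ^ 'q::{finite,linorder} \<Rightarrow> real mat" where
  "Sigma_mat T \<theta> = Theta T \<theta> * inv_mat (Kmat T \<theta>) * (Theta T \<theta>)\<^sup>T"

section \<open>Data and estimators\<close>

text \<open>The data are \<open>X 1, \<dots>, X (T + p)\<close>. With rows numbered from 0, row \<open>t\<close> of \<open>L\<^sup>i\<^bold>X\<close> is
  \<open>X (p - i + 1 + t)\<close>.\<close>

definition lagged :: "nat \<Rightarrow> nat \<Rightarrow> nat \<Rightarrow> (nat \<Rightarrow> real vec) \<Rightarrow> nat \<Rightarrow> real mat" where
  "lagged T k p X i = mat T k (\<lambda>(t, j). X (p - i + 1 + t) $ j)"

text \<open>Column 0 is the constant one; column \<open>1 + (i - 1) * k + m\<close> with \<open>m < k\<close> is column \<open>m\<close> of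
  \<open>L\<^sup>i\<^bold>X\<close>.\<close>

definition X_lag :: "nat \<Rightarrow> nat \<Rightarrow> nat \<Rightarrow> (nat \<Rightarrow> real vec) \<Rightarrow> real mat" where
  "X_lag T k p X = mat T (1 + p * k) (\<lambda>(t, j).
     if j = 0 then 1 else lagged T k p X ((j - 1) div k + 1) $$ (t, (j - 1) mod k))"

definition residuals ::
  "nat \<Rightarrow> nat \<Rightarrow> nat \<Rightarrow> (nat \<Rightarrow> real vec) \<Rightarrow> real mat \<Rightarrow> (nat \<Rightarrow> real mat) \<Rightarrow> real mat" where
  "residuals T k p X \<mu> \<Phi> = mat T k (\<lambda>(t, j).
     lagged T k p X 0 $$ (t, j) - \<mu> $$ (0, j)
       - (\<Sum>i=1..p. (lagged T k p X i * \<Phi> i) $$ (t, j)))"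

definition X_theta ::
  "nat \<Rightarrow> nat \<Rightarrow> nat \<Rightarrow> (nat \<Rightarrow> real vec) \<Rightarrow> real ^ 'q::{finite,linorder} \<Rightarrow> real mat" where
  "X_theta T k p X \<theta> = inv_mat (Theta T \<theta>) * lagged T k p X 0"

definition X_theta_lag ::
  "nat \<Rightarrow> nat \<Rightarrow> nat \<Rightarrow> (nat \<Rightarrow> real vec) \<Rightarrow> real ^ 'q::{finite,linorder} \<Rightarrow> real mat" where
  "X_theta_lag T k p X \<theta> = inv_mat (Theta T \<theta>) * X_lag T k p X"

definition mu_Phi_opt ::
  "nat \<Rightarrow> nat \<Rightarrow> nat \<Rightarrow> (nat \<Rightarrow> real vec) \<Rightarrow> real ^ 'q::{finite,linorder} \<Rightarrow> real mat" where
  "mu_Phi_opt T k p X \<theta> =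
     (let Y = X_theta T k p X \<theta>; W = X_theta_lag T k p X \<theta>; K = Kmat T \<theta>
      in inv_mat (W\<^sup>T * K * W) * W\<^sup>T * K * Y)"

definition Omega_opt ::
  "nat \<Rightarrow> nat \<Rightarrow> nat \<Rightarrow> (nat \<Rightarrow> real vec) \<Rightarrow> real ^ 'q::{finite,linorder} \<Rightarrow> real mat" where
  "Omega_opt T k p X \<theta> =
     (let Y = X_theta T k p X \<theta>; W = X_theta_lag T k p X \<theta>; K = Kmat T \<theta>
      in (1 / real T) \<cdot>\<^sub>m (Y\<^sup>T * K * Y - Y\<^sup>T * K * W * inv_mat (W\<^sup>T * K * W) * W\<^sup>T * K * Y))"

section \<open>Conditional log-likelihood functions\<close>

definition log_lik ::
  "nat \<Rightarrow> nat \<Rightarrow> nat \<Rightarrow> (nat \<Rightarrow> real vec) \<Rightarrow> real ^ 'q::{finite,linorder}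
   \<Rightarrow> real mat \<Rightarrow> (nat \<Rightarrow> real mat) \<Rightarrow> real mat \<Rightarrow> real" where
  "log_lik T k p X \<theta> \<mu> \<Phi> \<Omega> =
     (let Z = residuals T k p X \<mu> \<Phi>; V = inv_mat (Theta T \<theta>)
      in - (real T * real k / 2) * ln (2 * pi) - (real T / 2) * ln (det \<Omega>)
         - (real k / 2) * ln (det (Kbar T \<theta>))
         - (1 / 2) * mat_trace (Z\<^sup>T * V\<^sup>T * Kmat T \<theta> * V * Z * inv_mat \<Omega>))"

definition profile_log_lik ::
  "nat \<Rightarrow> nat \<Rightarrow> nat \<Rightarrow> (nat \<Rightarrow> real vec) \<Rightarrow> real ^ 'q::{finite,linorder} \<Rightarrow> real" where
  "profile_log_lik T k p X \<theta> =
     - (real T * real k / 2) * ln (2 * pi) - (real T / 2) * ln (det (Omega_opt T k p X \<theta>))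
     - (real k / 2) * ln (det (Kbar T \<theta>)) - real T * real k / 2"

end

(*
  By the Woodbury identity, Sigma_T = Theta_T Theta_T' + Theta_{*;T-q} Theta_{*;T-q}', which is the
  Toeplitz matrix of the autocovariances, and det Kbar = det Sigma_T by Sylvester's identity. All
  estimators and likelihoods depend on theta only through Sigma_T. As
  (1 - a L)(L - a) = a^2 (1 - L / a)(L - 1 / a), inverting the chosen roots divides all autocovariances,
  hence Sigma_T, by c^2, and parts (a) to (g) follow.
  For (h), near a theta with distinct roots the map from roots to coefficients is continuous and
  injective, so by invariance of domain the roots are continuous functions of the coefficients; at a
  simple root they are even differentiable. Hence IR is differentiable, and (h) is the chain
  rule for the identity of (g).
*)

theory Submission
  imports Defs
begin

section \<open>Matrices with explicit carriers\<close>

text \<open>\<open>Kbar\<close> and \<open>Kmat\<close> are not visibly rescaled when roots are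
  inverted; \<open>Sigma_mat\<close> is, because its entries are the numbers \<open>acov\<close>. So
  the effect on the estimators and likelihoods is derived from one abstract relation,
  \<open>Sigma_mat T \<theta>' = inverse s \<cdot>\<^sub>m Sigma_mat T \<theta>\<close> with s > 0.
  In the end s is the square of c, and its positivity, used in the logarithms, comes from the
  positive variances at lag 0. Autocovariances are read off the product of the polynomial with its
  reversal. The reversal has the right length only if the degree is exactly q, which is where
  nonzero roots matter. In (h) the obstacle is reality: the map from roots to coefficients is
  inverted on complex vectors, where source and target have equal dimension, whereas IR must send
  real vectors to real vectors. The conjugation symmetry of the chosen roots, given at \<theta>
  only, must be carried over to neighbouring polynomials; disjoint discs around the roots keep track
  of which root is which. Topology yields only continuity of the roots, and a difference quotient
  identity upgrades it to differentiability at \<theta>.\<close>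

lemma mult_mat_assoc_dim:
  fixes A B C :: "'a::semiring_0 mat"
  assumes "dim_col A = dim_row B" "dim_col B = dim_row C"
  shows "A * B * C = A * (B * C)"
  by (rule assoc_mult_mat[of A "dim_row A" "dim_col A" B "dim_col B" C "dim_col C"]) (use assms in auto)

lemma transpose_mult_dim:
  fixes A B :: "'a::comm_semiring_0 mat"
  assumes "dim_col A = dim_row B"
  shows "(A * B)\<^sup>T = B\<^sup>T * A\<^sup>T"
  by (rule transpose_mult[of A "dim_row A" "dim_col A" B "dim_col B"]) (use assms in auto)

lemma smult_mult_left_dim:
  fixes A B :: "'a::comm_semiring_0 mat"
  assumes "dim_col A = dim_row B"
  shows "(a \<cdot>\<^sub>m A) * B = a \<cdot>\<^sub>m (A * B)"
  by (rule mult_smult_assoc_mat[of A "dim_row A" "dim_col A" B "dim_col B"]) (use assms in auto)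

lemma smult_mult_right_dim:
  fixes A B :: "'a::comm_semiring_0 mat"
  assumes "dim_col A = dim_row B"
  shows "A * (a \<cdot>\<^sub>m B) = a \<cdot>\<^sub>m (A * B)"
  by (rule mult_smult_distrib[of A "dim_row A" "dim_col A" B "dim_col B"]) (use assms in auto)

lemma smult_smult_mat: "a \<cdot>\<^sub>m (b \<cdot>\<^sub>m A) = (a * b) \<cdot>\<^sub>m (A :: 'a::semigroup_mult mat)"
  by (rule eq_matI) (auto simp: mult.assoc)

lemma one_smult_mat [simp]: "1 \<cdot>\<^sub>m A = (A :: 'a::monoid_mult mat)"
  by (rule eq_matI) auto

text \<open>\<open>mat_inverse\<close> returns an option. The product equation makes det A nonzero,
  so the option is \<open>Some C\<close>, and C = C A B = B. Most inverses below are identified by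
  exhibiting a right inverse.\<close>

lemma inv_mat_unique:
  assumes A: "A \<in> carrier_mat n n" and B: "B \<in> carrier_mat n n" and AB: "A * B = 1\<^sub>m n"
  shows "inv_mat A = B"
proof -
  have BA: "B * A = 1\<^sub>m n" by (rule mat_mult_left_right_inverse[OF A B AB])
  have "det A * det B = 1" using det_mult[OF A B] AB by simp
  hence "det A \<noteq> 0" by auto
  hence "mat_inverse A \<noteq> None"
    using mat_inverse(1)[OF A, of undefined] det_non_zero_imp_unit[OF A, of undefined] by blast
  then obtain C where C: "mat_inverse A = Some C" by auto
  have AC: "C * A = 1\<^sub>m n" "C \<in> carrier_mat n n" using mat_inverse(2)[OF A C] by auto
  have "C = C * (A * B)" using AC AB by simp
  also have "\<dots> = C * A * B" by (rule assoc_mult_mat[OF AC(2) A B, symmetric])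
  also have "\<dots> = B" using AC B by simp
  finally show ?thesis using C by (simp add: inv_mat_def)
qed

text \<open>Presents the inverse as a rational function of the entries, which later makes the
  estimators differentiable.\<close>

lemma inv_mat_eq_adj:
  assumes A: "A \<in> carrier_mat n n" and d: "det A \<noteq> 0"
  shows "inv_mat A = inverse (det A) \<cdot>\<^sub>m adj_mat A"
proof (rule inv_mat_unique[OF A])
  show "inverse (det A) \<cdot>\<^sub>m adj_mat A \<in> carrier_mat n n" using adj_mat(1)[OF A] by simp
  have "A * (inverse (det A) \<cdot>\<^sub>m adj_mat A) = inverse (det A) \<cdot>\<^sub>m (det A \<cdot>\<^sub>m 1\<^sub>m n)"
    using adj_mat(1)[OF A] A adj_mat(2)[OF A] by (subst smult_mult_right_dim) auto
  also have "\<dots> = 1\<^sub>m n" using d by (simp add: smult_smult_mat)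
  finally show "A * (inverse (det A) \<cdot>\<^sub>m adj_mat A) = 1\<^sub>m n" .
qed

lemma inv_mat:
  assumes A: "A \<in> carrier_mat n n" and d: "det A \<noteq> 0"
  shows "inv_mat A \<in> carrier_mat n n" "A * inv_mat A = 1\<^sub>m n" "inv_mat A * A = 1\<^sub>m n"
proof -
  show 1: "inv_mat A \<in> carrier_mat n n" unfolding inv_mat_eq_adj[OF A d] using adj_mat(1)[OF A] by simp
  show 2: "A * inv_mat A = 1\<^sub>m n"
    unfolding inv_mat_eq_adj[OF A d]
    using adj_mat(1)[OF A] A adj_mat(2)[OF A] d
    by (subst smult_mult_right_dim) (auto simp: smult_smult_mat)
  show "inv_mat A * A = 1\<^sub>m n" by (rule mat_mult_left_right_inverse[OF A 1 2])
qed

lemma inv_mat_smult: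
  assumes A: "A \<in> carrier_mat n n" and d: "det A \<noteq> 0" and a: "a \<noteq> 0"
  shows "inv_mat (a \<cdot>\<^sub>m A) = inverse a \<cdot>\<^sub>m inv_mat A"
proof (rule inv_mat_unique)
  note I = inv_mat[OF A d]
  show "a \<cdot>\<^sub>m A \<in> carrier_mat n n" "inverse a \<cdot>\<^sub>m inv_mat A \<in> carrier_mat n n" using A I by auto
  show "a \<cdot>\<^sub>m A * (inverse a \<cdot>\<^sub>m inv_mat A) = 1\<^sub>m n"
    using A I a by (simp add: smult_mult_left_dim smult_mult_right_dim smult_smult_mat)
qed

lemma inv_mat_mult:
  assumes A: "A \<in> carrier_mat n n" and B: "B \<in> carrier_mat n n"
    and "det A \<noteq> 0" "det B \<noteq> 0"
  shows "inv_mat (A * B) = inv_mat B * inv_mat A"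
proof (rule inv_mat_unique)
  note IA = inv_mat[OF A assms(3)] and IB = inv_mat[OF B assms(4)]
  show "A * B \<in> carrier_mat n n" "inv_mat B * inv_mat A \<in> carrier_mat n n" using A B IA IB by auto
  have "A * B * (inv_mat B * inv_mat A) = A * (B * (inv_mat B * inv_mat A))"
    using A B IA IB by (simp add: mult_mat_assoc_dim)
  also have "B * (inv_mat B * inv_mat A) = B * inv_mat B * inv_mat A"
    by (rule assoc_mult_mat[OF B IB(1) IA(1), symmetric])
  also have "A * (B * inv_mat B * inv_mat A) = 1\<^sub>m n" using IA IB by simp
  finally show "A * B * (inv_mat B * inv_mat A) = 1\<^sub>m n" .
qed

lemma inv_mat_transpose:
  assumes A: "A \<in> carrier_mat n n" and d: "det A \<noteq> 0"
  shows "inv_mat (A\<^sup>T) = (inv_mat A)\<^sup>T"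
proof (rule inv_mat_unique)
  note I = inv_mat[OF A d]
  show "A\<^sup>T \<in> carrier_mat n n" "(inv_mat A)\<^sup>T \<in> carrier_mat n n" using A I by auto
  show "A\<^sup>T * (inv_mat A)\<^sup>T = 1\<^sub>m n"
    using transpose_mult_dim[of "inv_mat A" A] A I by auto
qed

lemma inv_mat_inv_mat:
  assumes A: "A \<in> carrier_mat n n" and d: "det A \<noteq> 0"
  shows "inv_mat (inv_mat A) = A"
  by (rule inv_mat_unique[OF inv_mat(1)[OF A d] A inv_mat(3)[OF A d]])

lemma det_inv_mat:
  assumes A: "A \<in> carrier_mat n n" and d: "det A \<noteq> 0"
  shows "det (inv_mat A) \<noteq> 0"
proof
  assume "det (inv_mat A) = 0"
  hence "det (A * inv_mat A) = 0" using det_mult[OF A inv_mat(1)[OF A d]] by simp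
  thus False using inv_mat(2)[OF A d] by simp
qed

text \<open>Sylvester's identity. R is unit triangular, so \<open>M * R\<close> and
  \<open>R * M\<close> both have determinant det M; both are block triangular, with the two matrices
  of the claim as their nontrivial diagonal blocks.\<close>

lemma det_one_plus_mult_commute:
  fixes A B :: "'a::idom mat"
  assumes A: "A \<in> carrier_mat n m" and B: "B \<in> carrier_mat m n"
  shows "det (1\<^sub>m n + A * B) = det (1\<^sub>m m + B * A)"
proof -
  define M where "M = four_block_mat (1\<^sub>m n) (- A) B (1\<^sub>m m)"
  define R where "R = four_block_mat (1\<^sub>m n) A (0\<^sub>m m n) (1\<^sub>m m)"
  have M: "M \<in> carrier_mat (n + m) (n + m)" and R: "R \<in> carrier_mat (n + m) (n + m)"
    using A B by (auto simp: M_def R_def)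
  have "det R = 1"
    unfolding R_def using A
    by (subst det_four_block_mat_lower_left_zero[of _ n _ m]) auto
  have neg: "A + - A = 0\<^sub>m n m" using A by auto
  have neg': "- A + A = 0\<^sub>m n m" using A by auto
  have "M * R = four_block_mat (1\<^sub>m n) (0\<^sub>m n m) B (1\<^sub>m m + B * A)"
    unfolding M_def R_def using A B
    by (subst mult_four_block_mat[of _ n n _ m _ m]) (auto simp: neg comm_add_mat[of _ m m])
  hence 1: "det (M * R) = det (1\<^sub>m m + B * A)"
    using A B by (simp add: det_four_block_mat_upper_right_zero[of _ n _ m])
  have "R * M = four_block_mat (1\<^sub>m n + A * B) (0\<^sub>m n m) B (1\<^sub>m m)"
    unfolding M_def R_def using A B
    by (subst mult_four_block_mat[of _ n n _ m _ m]) (auto simp: neg')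
  hence 2: "det (R * M) = det (1\<^sub>m n + A * B)"
    using A B by (simp add: det_four_block_mat_upper_right_zero[of _ n _ m])
  show ?thesis using 1 2 det_mult[OF M R] det_mult[OF R M] by (simp add: mult.commute)
qed

section \<open>Positive definite matrices\<close>

lemma scalar_prod_self_pos:
  fixes v :: "real vec"
  assumes "v \<in> carrier_vec n" "v \<noteq> 0\<^sub>v n"
  shows "v \<bullet> v > 0"
proof -
  obtain i where i: "i < n" "v $ i \<noteq> 0" using assms by (metis carrier_vecD eq_vecI index_zero_vec)
  have "v \<bullet> v = (\<Sum>i<n. (v $ i)\<^sup>2)"
    using assms by (simp add: scalar_prod_def power2_eq_square atLeast0LessThan)
  also have "\<dots> > 0" using i by (intro sum_pos2[of _ i]) auto
  finally show ?thesis .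
qed

lemma scalar_prod_self_nonneg: "v \<bullet> v \<ge> (0::real)"
  by (auto simp: scalar_prod_def intro: sum_nonneg)

lemma positive_definite_det:
  assumes "positive_definite n A"
  shows "det A \<noteq> 0"
proof
  assume "det A = 0"
  then obtain v where v: "v \<in> carrier_vec n" "v \<noteq> 0\<^sub>v n" "A *\<^sub>v v = 0\<^sub>v n"
    using assms det_0_iff_vec_prod_zero[of A n] by (auto simp: positive_definite_def)
  hence "v \<bullet> (A *\<^sub>v v) = 0" by simp
  thus False using assms v(1,2) by (force simp: positive_definite_def)
qed

text \<open>The quadratic form is |v|^2 + |B'v|^2. It serves B = \<lambda> (for
  \<open>Sigma_mat\<close>) and B = \<lambda>' (for \<open>Kbar\<close>).\<close>

lemma positive_definite_one_plus:
  assumes B: "B \<in> carrier_mat n m"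
  shows "positive_definite n (1\<^sub>m n + B * B\<^sup>T)"
  unfolding positive_definite_def
proof (intro conjI ballI impI)
  show "1\<^sub>m n + B * B\<^sup>T \<in> carrier_mat n n" using B by auto
  have "(1\<^sub>m n + B * B\<^sup>T)\<^sup>T = (1\<^sub>m n)\<^sup>T + (B * B\<^sup>T)\<^sup>T" using B by (intro transpose_add) auto
  thus "(1\<^sub>m n + B * B\<^sup>T)\<^sup>T = 1\<^sub>m n + B * B\<^sup>T" by (simp add: transpose_mult_dim)
  fix v :: "real vec" assume v: "v \<in> carrier_vec n" "v \<noteq> 0\<^sub>v n"
  have "v \<bullet> ((1\<^sub>m n + B * B\<^sup>T) *\<^sub>v v) = v \<bullet> (v + B *\<^sub>v (B\<^sup>T *\<^sub>v v))"
    using B v by (subst add_mult_distrib_mat_vec[of _ n n]) auto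
  also have "\<dots> = v \<bullet> v + v \<bullet> (B *\<^sub>v (B\<^sup>T *\<^sub>v v))"
    using B v by (intro scalar_prod_add_distrib[of _ n]) auto
  also have "v \<bullet> (B *\<^sub>v (B\<^sup>T *\<^sub>v v)) = (B\<^sup>T *\<^sub>v v) \<bullet> (B\<^sup>T *\<^sub>v v)"
    using B v by (intro transpose_vec_mult_scalar[symmetric, of _ n m]) auto
  finally show "0 < v \<bullet> ((1\<^sub>m n + B * B\<^sup>T) *\<^sub>v v)"
    using scalar_prod_self_pos[OF v] scalar_prod_self_nonneg[of "B\<^sup>T *\<^sub>v v"] by simp
qed

text \<open>The form at v is that of A at W v, and W v is nonzero. Used for inverses (W the inverse
  of A), for \<open>Sigma_mat\<close> (W the transpose of \<open>Theta\<close>) and for the Gram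
  matrix of the regressors.\<close>

lemma positive_definite_congruence:
  assumes A: "positive_definite n A" and W: "W \<in> carrier_mat n m"
    and inj: "\<And>v. v \<in> carrier_vec m \<Longrightarrow> W *\<^sub>v v = 0\<^sub>v n \<Longrightarrow> v = 0\<^sub>v m"
  shows "positive_definite m (W\<^sup>T * A * W)"
  unfolding positive_definite_def
proof (intro conjI ballI impI)
  have Ac: "A \<in> carrier_mat n n" and At: "A\<^sup>T = A" using A by (auto simp: positive_definite_def)
  show "W\<^sup>T * A * W \<in> carrier_mat m m" using W Ac by auto
  show "(W\<^sup>T * A * W)\<^sup>T = W\<^sup>T * A * W"
    using W Ac by (simp add: transpose_mult_dim At mult_mat_assoc_dim)
  fix v :: "real vec" assume v: "v \<in> carrier_vec m" "v \<noteq> 0\<^sub>v m"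
  have "v \<bullet> (W\<^sup>T * A * W *\<^sub>v v) = v \<bullet> (W\<^sup>T *\<^sub>v (A *\<^sub>v (W *\<^sub>v v)))"
    using W Ac v assoc_mult_mat_vec[of "W\<^sup>T * A" m n W m v] assoc_mult_mat_vec[of "W\<^sup>T" m n A n "W *\<^sub>v v"]
    by auto
  also have "\<dots> = (W *\<^sub>v v) \<bullet> (A *\<^sub>v (W *\<^sub>v v))"
    using W Ac v transpose_vec_mult_scalar[of "W\<^sup>T" m n "A *\<^sub>v (W *\<^sub>v v)" v] by auto
  also have "\<dots> > 0"
    using A inj[of v] mult_mat_vec_carrier[OF W v(1)] v by (auto simp: positive_definite_def simp del: mult_mat_vec_carrier)
  finally show "0 < v \<bullet> (W\<^sup>T * A * W *\<^sub>v v)" .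
qed

lemma inj_mult_mat_vec:
  fixes A :: "'a::idom mat"
  assumes "A \<in> carrier_mat n n" "det A \<noteq> 0" "v \<in> carrier_vec n" "A *\<^sub>v v = 0\<^sub>v n"
  shows "v = 0\<^sub>v n"
  using assms det_0_iff_vec_prod_zero[of A n] by auto

lemma positive_definite_inv_mat:
  assumes A: "positive_definite n A"
  shows "positive_definite n (inv_mat A)"
proof -
  have Ac: "A \<in> carrier_mat n n" and At: "A\<^sup>T = A" using A by (auto simp: positive_definite_def)
  have d: "det A \<noteq> 0" by (rule positive_definite_det[OF A])
  note I = inv_mat[OF Ac d]
  have "positive_definite n ((inv_mat A)\<^sup>T * A * inv_mat A)"
    using A I(1) by (rule positive_definite_congruence)
      (rule inj_mult_mat_vec[OF I(1) det_inv_mat[OF Ac d]])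
  also have "(inv_mat A)\<^sup>T * A * inv_mat A = inv_mat A"
    using inv_mat_transpose[OF Ac d] At I by simp
  finally show ?thesis .
qed

lemma full_column_rank_inj:
  fixes A :: "'a::field mat"
  assumes A: "A \<in> carrier_mat n m" and rank: "vec_space.rank n A = m"
    and v: "v \<in> carrier_vec m" "A *\<^sub>v v = 0\<^sub>v n"
  shows "v = 0\<^sub>v m"
proof (rule ccontr)
  assume nz: "v \<noteq> 0\<^sub>v m"
  interpret vec_space "TYPE('a)" n .
  obtain S where S: "maximal S (\<lambda>T. T \<subseteq> set (cols A) \<and> lin_indpt T)"
    using maximal_exists[of "(\<lambda>T. T \<subseteq> set (cols A) \<and> lin_indpt T)" "card (set (cols A))" "{}"]
    by (meson List.finite_set card_mono empty_iff empty_subsetI finite_lin_indpt2 rev_finite_subset)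
  \<comment> \<open>The rank is computed from the set of columns, so a repeated column has to be
    excluded: an independent subset with m elements leaves no room for one.\<close>
  have "m = card S" using rank_card_indpt[OF A S] rank by simp
  also have "\<dots> \<le> card (set (cols A))" using S by (simp add: card_mono maximal_def)
  finally have "distinct (cols A)"
    using A card_length[of "cols A"] by (intro card_distinct) auto
  thus False using lin_depI[OF A v(1) nz v(2)] full_rank_lin_indpt[OF A rank] by blast
qed

section \<open>The matrix \<open>\<Sigma>\<^sub>T\<close>\<close>

lemma ma_coeff_0 [simp]: "ma_coeff \<theta> 0 = 1"
  by (simp add: ma_coeff_def)

lemma ma_coeff_gt [simp]: "CARD('q) < i \<Longrightarrow> ma_coeff (\<theta> :: real ^ 'q::{finite,linorder}) i = 0"
  by (simp add: ma_coeff_def)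

context
  fixes T :: nat and \<theta> :: "real ^ 'q::{finite,linorder}"
  assumes T: "CARD('q) \<le> T"
begin

lemma Theta_carrier: "Theta T \<theta> \<in> carrier_mat T T"
  by (simp add: Theta_def)

lemma Theta_index: "i < T \<Longrightarrow> j < T \<Longrightarrow> Theta T \<theta> $$ (i, j) = (if j \<le> i then ma_coeff \<theta> (i - j) else 0)"
  by (simp add: Theta_def)

lemma det_Theta: "det (Theta T \<theta>) = 1"
proof -
  have "det (Theta T \<theta>) = prod_list (diag_mat (Theta T \<theta>))"
    by (rule det_lower_triangular[OF _ Theta_carrier]) (simp add: Theta_index)
  also have "\<dots> = 1" by (auto simp: prod_list_diag_prod Theta_def)
  finally show ?thesis .
qed

lemma Theta_star_ext_carrier: "Theta_star_ext T \<theta> \<in> carrier_mat T CARD('q)"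
  using T carrier_append_rows[of "Theta_star \<theta>" "CARD('q)" "CARD('q)" "0\<^sub>m (T - CARD('q)) CARD('q)" "T - CARD('q)"]
  by (simp add: Theta_star_ext_def Theta_star_def)

text \<open>One formula covers all regions: below the diagonal of \<open>Theta_star\<close> and in
  the zero block the index exceeds q, where \<open>ma_coeff\<close> vanishes.\<close>

lemma Theta_star_ext_index:
  assumes "i < T" "j < CARD('q)"
  shows "Theta_star_ext T \<theta> $$ (i, j) = ma_coeff \<theta> (i + CARD('q) - j)"
  using assms T by (auto simp: Theta_star_ext_def Theta_star_def append_rows_def add.commute[of i])

lemmas inv_Theta = inv_mat[OF Theta_carrier, unfolded det_Theta, OF one_neq_zero]

lemma lambda_mat_carrier: "lambda_mat T \<theta> \<in> carrier_mat T CARD('q)"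
  using inv_Theta(1) Theta_star_ext_carrier by (simp add: lambda_mat_def)

lemma Theta_lambda_mat: "Theta T \<theta> * lambda_mat T \<theta> = Theta_star_ext T \<theta>"
proof -
  have "Theta T \<theta> * lambda_mat T \<theta> = Theta T \<theta> * inv_mat (Theta T \<theta>) * Theta_star_ext T \<theta>"
    unfolding lambda_mat_def
    by (rule assoc_mult_mat[OF Theta_carrier inv_Theta(1) Theta_star_ext_carrier, symmetric])
  thus ?thesis using inv_Theta Theta_star_ext_carrier by simp
qed

lemma Kbar_carrier: "Kbar T \<theta> \<in> carrier_mat CARD('q) CARD('q)"
  using lambda_mat_carrier by (simp add: Kbar_def)

lemma Kbar_pd: "positive_definite CARD('q) (Kbar T \<theta>)"
  using positive_definite_one_plus[of "(lambda_mat T \<theta>)\<^sup>T" "CARD('q)" T] lambda_mat_carrier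
  by (simp add: Kbar_def comm_add_mat[of _ "CARD('q)" "CARD('q)"])

text \<open>The Woodbury identity rests on the push-through rule \<lambda>'(1 + \<lambda>\<lambda>')
  = (\<lambda>'\<lambda> + 1)\<lambda>': it cancels the inverse of \<open>Kbar\<close>, so the
  correction term times 1 + \<lambda>\<lambda>' collapses to \<lambda>\<lambda>'.\<close>

lemma Kmat_mult:
  "Kmat T \<theta> * (1\<^sub>m T + lambda_mat T \<theta> * (lambda_mat T \<theta>)\<^sup>T) = 1\<^sub>m T"
proof -
  let ?l = "lambda_mat T \<theta>" and ?K = "Kbar T \<theta>" and ?q = "CARD('q)"
  note l = lambda_mat_carrier
  have lt: "?l\<^sup>T \<in> carrier_mat ?q T" using l by simp
  note I = inv_mat[OF Kbar_carrier positive_definite_det[OF Kbar_pd]]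
  have "?l\<^sup>T * (1\<^sub>m T + ?l * ?l\<^sup>T) = ?l\<^sup>T + ?l\<^sup>T * ?l * ?l\<^sup>T"
    using l lt by (subst mult_add_distrib_mat[of _ ?q T]) (auto simp: mult_mat_assoc_dim)
  also have "\<dots> = ?K * ?l\<^sup>T"
    unfolding Kbar_def using l lt
    by (subst add_mult_distrib_mat[of _ ?q ?q]) (auto simp: comm_add_mat[of _ ?q T])
  finally have "?l * inv_mat ?K * ?l\<^sup>T * (1\<^sub>m T + ?l * ?l\<^sup>T) = ?l * (inv_mat ?K * (?K * ?l\<^sup>T))"
    using l lt I by (simp add: mult_mat_assoc_dim)
  also have "inv_mat ?K * (?K * ?l\<^sup>T) = inv_mat ?K * ?K * ?l\<^sup>T"
    by (rule assoc_mult_mat[OF I(1) Kbar_carrier lt, symmetric])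
  also have "\<dots> = ?l\<^sup>T" unfolding I(3) using lt by simp
  finally have *: "?l * inv_mat ?K * ?l\<^sup>T * (1\<^sub>m T + ?l * ?l\<^sup>T) = ?l * ?l\<^sup>T" .
  have "Kmat T \<theta> * (1\<^sub>m T + ?l * ?l\<^sup>T)
      = 1\<^sub>m T * (1\<^sub>m T + ?l * ?l\<^sup>T) - ?l * inv_mat ?K * ?l\<^sup>T * (1\<^sub>m T + ?l * ?l\<^sup>T)"
    unfolding Kmat_def using l lt I(1)
    by (intro minus_mult_distrib_mat[of _ T T _ _ T]) auto
  also have "\<dots> = 1\<^sub>m T * (1\<^sub>m T + ?l * ?l\<^sup>T) - ?l * ?l\<^sup>T" by (simp only: *)
  also have "\<dots> = 1\<^sub>m T" using l by (intro eq_matI) auto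
  finally show ?thesis .
qed

lemma Kmat_carrier: "Kmat T \<theta> \<in> carrier_mat T T"
  using lambda_mat_carrier inv_mat(1)[OF Kbar_carrier positive_definite_det[OF Kbar_pd]]
  unfolding Kmat_def by (intro minus_carrier_mat mult_carrier_mat[of _ _ "CARD('q)"]) auto

lemma inv_Kmat: "inv_mat (Kmat T \<theta>) = 1\<^sub>m T + lambda_mat T \<theta> * (lambda_mat T \<theta>)\<^sup>T"
  using lambda_mat_carrier by (intro inv_mat_unique[OF Kmat_carrier _ Kmat_mult]) auto

lemma det_Kmat: "det (Kmat T \<theta>) \<noteq> 0"
proof
  assume "det (Kmat T \<theta>) = 0"
  hence "det (Kmat T \<theta> * (1\<^sub>m T + lambda_mat T \<theta> * (lambda_mat T \<theta>)\<^sup>T)) = 0"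
    using lambda_mat_carrier by (subst det_mult[OF Kmat_carrier]) auto
  thus False by (simp add: Kmat_mult)
qed

lemma Sigma_mat_pd: "positive_definite T (Sigma_mat T \<theta>)"
proof -
  have Tt: "(Theta T \<theta>)\<^sup>T \<in> carrier_mat T T" using Theta_carrier by simp
  have "det ((Theta T \<theta>)\<^sup>T) \<noteq> 0" by (simp add: det_transpose[OF Theta_carrier] det_Theta)
  from positive_definite_congruence[OF positive_definite_one_plus[OF lambda_mat_carrier] Tt inj_mult_mat_vec[OF Tt this]]
  show ?thesis unfolding Sigma_mat_def inv_Kmat by simp
qed

lemma Sigma_mat_carrier: "Sigma_mat T \<theta> \<in> carrier_mat T T"
  using Sigma_mat_pd by (simp add: positive_definite_def)

lemma det_Sigma_mat: "det (Sigma_mat T \<theta>) = det (Kbar T \<theta>)"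
proof -
  let ?l = "lambda_mat T \<theta>"
  have c: "1\<^sub>m T + ?l * ?l\<^sup>T \<in> carrier_mat T T" using lambda_mat_carrier by auto
  have "det (Sigma_mat T \<theta>) = det (1\<^sub>m T + ?l * ?l\<^sup>T)"
    unfolding Sigma_mat_def inv_Kmat
    using c Theta_carrier
    by (simp add: det_mult[of _ T] det_transpose[OF Theta_carrier] det_Theta del: assoc_mult_mat)
  also have "\<dots> = det (1\<^sub>m CARD('q) + ?l\<^sup>T * ?l)"
    using lambda_mat_carrier by (intro det_one_plus_mult_commute[of _ T "CARD('q)"]) auto
  also have "\<dots> = det (Kbar T \<theta>)"
    unfolding Kbar_def using lambda_mat_carrier
    by (simp add: comm_add_mat[of "1\<^sub>m CARD('q)" "CARD('q)" "CARD('q)"])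
  finally show ?thesis .
qed

text \<open>In the estimators and in the trace term, \<open>Kmat\<close> always stands between these
  two factors.\<close>

lemma inv_Sigma_mat:
  "inv_mat (Sigma_mat T \<theta>) = (inv_mat (Theta T \<theta>))\<^sup>T * Kmat T \<theta> * inv_mat (Theta T \<theta>)"
proof -
  have d: "det (Theta T \<theta>) \<noteq> 0" "det ((Theta T \<theta>)\<^sup>T) \<noteq> 0"
    using det_Theta det_transpose[OF Theta_carrier] by auto
  note IK = inv_mat[OF Kmat_carrier det_Kmat]
  have d2: "det (inv_mat (Kmat T \<theta>)) \<noteq> 0" by (rule det_inv_mat[OF Kmat_carrier det_Kmat])
  have d3: "det (Theta T \<theta> * inv_mat (Kmat T \<theta>)) \<noteq> 0"
    using d d2 by (simp add: det_mult[OF Theta_carrier IK(1)])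
  have c: "(Theta T \<theta>)\<^sup>T \<in> carrier_mat T T" "Theta T \<theta> * inv_mat (Kmat T \<theta>) \<in> carrier_mat T T"
    using Theta_carrier IK by auto
  have "inv_mat (Sigma_mat T \<theta>) = inv_mat ((Theta T \<theta>)\<^sup>T) * (inv_mat (inv_mat (Kmat T \<theta>)) * inv_mat (Theta T \<theta>))"
    unfolding Sigma_mat_def
    by (simp only: inv_mat_mult[OF c(2,1) d3 d(2)] inv_mat_mult[OF Theta_carrier IK(1) d(1) d2])
  thus ?thesis
    using inv_Theta Kmat_carrier
    by (simp add: inv_mat_inv_mat[OF Kmat_carrier det_Kmat] inv_mat_transpose[OF Theta_carrier d(1)] mult_mat_assoc_dim)
qed

lemma Sigma_mat_eq:
  "Sigma_mat T \<theta> = Theta T \<theta> * (Theta T \<theta>)\<^sup>T + Theta_star_ext T \<theta> * (Theta_star_ext T \<theta>)\<^sup>T"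
proof -
  let ?l = "lambda_mat T \<theta>" and ?H = "Theta T \<theta>"
  have "Sigma_mat T \<theta> = (?H + ?H * ?l * ?l\<^sup>T) * ?H\<^sup>T"
    unfolding Sigma_mat_def inv_Kmat using Theta_carrier lambda_mat_carrier
    by (subst mult_add_distrib_mat[of _ T T]) (auto simp: mult_mat_assoc_dim)
  also have "\<dots> = ?H * ?H\<^sup>T + ?H * ?l * ?l\<^sup>T * ?H\<^sup>T"
    using Theta_carrier lambda_mat_carrier by (intro add_mult_distrib_mat[of _ T T]) auto
  also have "?H * ?l * ?l\<^sup>T * ?H\<^sup>T = ?H * ?l * (?H * ?l)\<^sup>T"
    using Theta_carrier lambda_mat_carrier by (simp add: mult_mat_assoc_dim transpose_mult_dim)
  finally show ?thesis by (simp add: Theta_lambda_mat)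
qed

text \<open>\<open>Theta\<close> supplies the products with m \<le> j, the part of the
  autocovariance seen inside the sample; \<open>Theta_star_ext\<close> supplies m = j+1, ..., j+q,
  the part cut off at the start. Together they exhaust all m \<le> q, so the value depends on i - j
  alone.\<close>

lemma Sigma_mat_index:
  assumes "j \<le> i" "i < T"
  shows "Sigma_mat T \<theta> $$ (i, j) = (\<Sum>m\<le>j + CARD('q). ma_coeff \<theta> (m + (i - j)) * ma_coeff \<theta> m)"
proof -
  let ?q = "CARD('q)" and ?c = "ma_coeff \<theta>" and ?d = "i - j"
  have j: "j < T" using assms by simp
  have "Sigma_mat T \<theta> $$ (i, j) = (\<Sum>s<T. Theta T \<theta> $$ (i, s) * Theta T \<theta> $$ (j, s))
      + (\<Sum>s<?q. Theta_star_ext T \<theta> $$ (i, s) * Theta_star_ext T \<theta> $$ (j, s))"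
    unfolding Sigma_mat_eq using Theta_carrier Theta_star_ext_carrier assms j
    by (simp add: scalar_prod_def atLeast0LessThan)
  also have "(\<Sum>s<T. Theta T \<theta> $$ (i, s) * Theta T \<theta> $$ (j, s)) = (\<Sum>s\<le>j. ?c (i - s) * ?c (j - s))"
    using assms j by (intro sum.mono_neutral_cong_right) (auto simp: Theta_index)
  also have "\<dots> = (\<Sum>m\<le>j. ?c (m + ?d) * ?c m)"
    using assms by (intro sum.reindex_bij_witness[of _ "\<lambda>m. j - m" "\<lambda>m. j - m"]) auto
  also have "(\<Sum>s<?q. Theta_star_ext T \<theta> $$ (i, s) * Theta_star_ext T \<theta> $$ (j, s))
      = (\<Sum>s<?q. ?c (i + ?q - s) * ?c (j + ?q - s))"
    by (intro sum.cong refl) (simp only: lessThan_iff Theta_star_ext_index[OF assms(2)] Theta_star_ext_index[OF j])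
  also have "\<dots> = (\<Sum>m\<in>{j<..j + ?q}. ?c (m + ?d) * ?c m)"
    using assms by (intro sum.reindex_bij_witness[of _ "\<lambda>m. j + ?q - m" "\<lambda>m. j + ?q - m"])
      (auto simp: add.commute[of i])
  also have "(\<Sum>m\<le>j. ?c (m + ?d) * ?c m) + \<dots> = (\<Sum>m\<in>{..j} \<union> {j<..j + ?q}. ?c (m + ?d) * ?c m)"
    by (intro sum.union_disjoint[symmetric]) auto
  also have "{..j} \<union> {j<..j + ?q} = {..j + ?q}" by auto
  finally show ?thesis .
qed

text \<open>Padding with vanishing terms makes the upper limit arbitrary from q on; in particular j
  + q is allowed, the limit that occurs in \<open>Sigma_mat_index\<close>.\<close>

lemma acov_eq_sum: "CARD('q) \<le> n \<Longrightarrow> acov \<theta> l = (\<Sum>m\<le>n. ma_coeff \<theta> (m + nat \<bar>l\<bar>) * ma_coeff \<theta> m)"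
proof (cases "nat \<bar>l\<bar> \<le> CARD('q)")
  case True
  assume "CARD('q) \<le> n"
  moreover have "i \<le> CARD('q) - nat \<bar>l\<bar>" if "ma_coeff \<theta> (i + nat \<bar>l\<bar>) \<noteq> 0" for i
    using that ma_coeff_gt[of "i + nat \<bar>l\<bar>" \<theta>] by (meson le_diff_conv2 not_le True)
  ultimately show ?thesis unfolding acov_def
    using True by (auto simp: mult.commute intro!: sum.mono_neutral_left)
next
  case False
  thus ?thesis by (simp add: acov_def)
qed

lemma Sigma_mat_toeplitz: "Sigma_mat T \<theta> = mat T T (\<lambda>(i, j). acov \<theta> (int i - int j))"
proof -
  have *: "Sigma_mat T \<theta> $$ (i, j) = acov \<theta> (int i - int j)" if "j \<le> i" "i < T" for i j
    using that Sigma_mat_index[OF that] acov_eq_sum[of "j + CARD('q)" "int i - int j"]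
    by (simp add: nat_diff_distrib)
  \<comment> \<open>The entry formula covers only j \<le> i; the upper half follows from the
    symmetry contained in positive definiteness.\<close>
  have sym: "Sigma_mat T \<theta> $$ (i, j) = Sigma_mat T \<theta> $$ (j, i)" if "i < T" "j < T" for i j
    using that Sigma_mat_pd index_transpose_mat(1)[of i "Sigma_mat T \<theta>" j] Sigma_mat_carrier
    by (auto simp: positive_definite_def)
  have even: "acov \<theta> (- l) = acov \<theta> l" for l by (simp add: acov_def)
  show ?thesis
  proof (rule eq_matI)
    fix i j assume "i < dim_row (mat T T (\<lambda>(i, j). acov \<theta> (int i - int j)))"
      and "j < dim_col (mat T T (\<lambda>(i, j). acov \<theta> (int i - int j)))"
    hence ij: "i < T" "j < T" by auto
    show "Sigma_mat T \<theta> $$ (i, j) = mat T T (\<lambda>(i, j). acov \<theta> (int i - int j)) $$ (i, j)"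
    proof (cases "j \<le> i")
      case True thus ?thesis using * ij by simp
    next
      case False
      hence "i \<le> j" by simp
      hence "Sigma_mat T \<theta> $$ (i, j) = acov \<theta> (- (int i - int j))"
        using *[OF _ ij(2), of i] sym[OF ij] by simp
      thus ?thesis unfolding even using ij by simp
    qed
  qed (use Sigma_mat_carrier in auto)
qed

end

section \<open>Estimators and likelihoods as functions of \<open>\<Sigma>\<^sub>T\<close>\<close>

abbreviation prec_mat :: "nat \<Rightarrow> real ^ 'q::{finite,linorder} \<Rightarrow> real mat" where
  "prec_mat T \<theta> \<equiv> inv_mat (Sigma_mat T \<theta>)"

lemma lagged_carrier: "lagged T k p X i \<in> carrier_mat T k"
  by (simp add: lagged_def)

lemma X_lag_carrier: "X_lag T k p X \<in> carrier_mat T (1 + p * k)"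
  by (simp add: X_lag_def)

lemma residuals_carrier: "residuals T k p X \<mu> \<Phi> \<in> carrier_mat T k"
  by (simp add: residuals_def)

context
  fixes T k p :: nat and \<theta> :: "real ^ 'q::{finite,linorder}" and X :: "nat \<Rightarrow> real vec"
  assumes T: "CARD('q) \<le> T"
    and full_rank: "vec_space.rank T (X_lag T k p X) = 1 + p * k"
begin

lemma prec_mat_pd: "positive_definite T (prec_mat T \<theta>)"
  by (rule positive_definite_inv_mat[OF Sigma_mat_pd[OF T]])

lemma prec_mat_carrier: "prec_mat T \<theta> \<in> carrier_mat T T"
  using prec_mat_pd by (simp add: positive_definite_def)

text \<open>Here the rank hypothesis enters: it makes the regressor matrix injective, so the normal
  equations have an invertible matrix and \<open>inv_mat\<close> is a true inverse.\<close>

lemma Gram_pd: "positive_definite (1 + p * k) ((X_lag T k p X)\<^sup>T * prec_mat T \<theta> * X_lag T k p X)"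
  by (rule positive_definite_congruence[OF prec_mat_pd X_lag_carrier full_column_rank_inj[OF X_lag_carrier full_rank]])

lemma Gram_carrier: "(X_lag T k p X)\<^sup>T * prec_mat T \<theta> * X_lag T k p X \<in> carrier_mat (1 + p * k) (1 + p * k)"
  using Gram_pd by (simp add: positive_definite_def)

lemmas inv_Gram = inv_mat[OF Gram_carrier positive_definite_det[OF Gram_pd]]

text \<open>A consequence of \<open>inv_Sigma_mat\<close>; it removes \<open>Theta\<close> and
  \<open>Kmat\<close> from both estimators at once.\<close>

lemma prec_mat_form:
  assumes "dim_row A = T" "dim_row B = T"
  shows "(inv_mat (Theta T \<theta>) * A)\<^sup>T * Kmat T \<theta> * (inv_mat (Theta T \<theta>) * B) = A\<^sup>T * prec_mat T \<theta> * B"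
  using assms inv_Theta[OF T, of \<theta>] Kmat_carrier[OF T, of \<theta>]
  by (simp add: inv_Sigma_mat[OF T] transpose_mult_dim mult_mat_assoc_dim del: assoc_mult_mat)

lemma mu_Phi_opt_eq:
  "mu_Phi_opt T k p X \<theta> =
     inv_mat ((X_lag T k p X)\<^sup>T * prec_mat T \<theta> * X_lag T k p X)
       * ((X_lag T k p X)\<^sup>T * prec_mat T \<theta> * lagged T k p X 0)"
proof -
  let ?V = "inv_mat (Theta T \<theta>)" and ?K = "Kmat T \<theta>"
  have dims: "dim_row (X_lag T k p X) = T" "dim_row (lagged T k p X 0) = T" using X_lag_carrier lagged_carrier by blast+
  have "mu_Phi_opt T k p X \<theta>
      = inv_mat ((?V * X_lag T k p X)\<^sup>T * ?K * (?V * X_lag T k p X))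
        * (?V * X_lag T k p X)\<^sup>T * ?K * (?V * lagged T k p X 0)"
    by (simp only: mu_Phi_opt_def X_theta_def X_theta_lag_def Let_def)
  also have "\<dots> = inv_mat ((X_lag T k p X)\<^sup>T * prec_mat T \<theta> * X_lag T k p X)
        * (?V * X_lag T k p X)\<^sup>T * ?K * (?V * lagged T k p X 0)"
    by (simp only: prec_mat_form[OF dims(1,1)])
  \<comment> \<open>The left-nested product of the definition is regrouped so that the last factors
    form one block of the shape in \<open>prec_mat_form\<close>.\<close>
  also have "\<dots> = inv_mat ((X_lag T k p X)\<^sup>T * prec_mat T \<theta> * X_lag T k p X)
        * ((?V * X_lag T k p X)\<^sup>T * ?K * (?V * lagged T k p X 0))"
    using inv_Theta[OF T, of \<theta>] Kmat_carrier[OF T, of \<theta>] inv_Gram(1) dims X_lag_carrier[of T k p X]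
    by (simp add: mult_mat_assoc_dim del: assoc_mult_mat)
  finally show ?thesis by (simp only: prec_mat_form[OF dims])
qed

lemma Omega_opt_eq:
  "Omega_opt T k p X \<theta> = (1 / real T) \<cdot>\<^sub>m
     ((lagged T k p X 0)\<^sup>T * prec_mat T \<theta> * lagged T k p X 0
        - ((lagged T k p X 0)\<^sup>T * prec_mat T \<theta> * X_lag T k p X)
            * inv_mat ((X_lag T k p X)\<^sup>T * prec_mat T \<theta> * X_lag T k p X)
            * ((X_lag T k p X)\<^sup>T * prec_mat T \<theta> * lagged T k p X 0))"
proof -
  let ?V = "inv_mat (Theta T \<theta>)" and ?K = "Kmat T \<theta>"
  have dims: "dim_row (X_lag T k p X) = T" "dim_row (lagged T k p X 0) = T" using X_lag_carrier lagged_carrier by blast+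
  let ?B = "inv_mat ((?V * X_lag T k p X)\<^sup>T * ?K * (?V * X_lag T k p X))"
  have "Omega_opt T k p X \<theta> = (1 / real T) \<cdot>\<^sub>m
     ((?V * lagged T k p X 0)\<^sup>T * ?K * (?V * lagged T k p X 0)
        - (?V * lagged T k p X 0)\<^sup>T * ?K * (?V * X_lag T k p X) * ?B * (?V * X_lag T k p X)\<^sup>T * ?K * (?V * lagged T k p X 0))"
    by (simp only: Omega_opt_def X_theta_def X_theta_lag_def Let_def)
  also have "(?V * lagged T k p X 0)\<^sup>T * ?K * (?V * X_lag T k p X) * ?B * (?V * X_lag T k p X)\<^sup>T * ?K * (?V * lagged T k p X 0)
    = ((?V * lagged T k p X 0)\<^sup>T * ?K * (?V * X_lag T k p X))
        * inv_mat ((X_lag T k p X)\<^sup>T * prec_mat T \<theta> * X_lag T k p X)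
        * ((?V * X_lag T k p X)\<^sup>T * ?K * (?V * lagged T k p X 0))"
    unfolding prec_mat_form[OF dims(1,1)]
    using inv_Theta[OF T, of \<theta>] Kmat_carrier[OF T, of \<theta>] inv_Gram(1) dims X_lag_carrier[of T k p X]
    by (simp add: mult_mat_assoc_dim del: assoc_mult_mat)
  finally show ?thesis by (simp only: prec_mat_form[OF dims] prec_mat_form[OF dims(2,2)] prec_mat_form[OF dims(2,1)])
qed

lemma Omega_opt_carrier: "Omega_opt T k p X \<theta> \<in> carrier_mat k k"
proof -
  have "dim_row (lagged T k p X 0) = T" "dim_col (lagged T k p X 0) = k" using lagged_carrier by blast+
  thus ?thesis unfolding Omega_opt_eq by (intro carrier_matI) simp_all
qed

lemma log_lik_eq:
  "log_lik T k p X \<theta> \<mu> \<Phi> \<Omega> =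
     - (real T * real k / 2) * ln (2 * pi) - (real T / 2) * ln (det \<Omega>)
     - (real k / 2) * ln (det (Sigma_mat T \<theta>))
     - (1 / 2) * mat_trace ((residuals T k p X \<mu> \<Phi>)\<^sup>T * prec_mat T \<theta> * residuals T k p X \<mu> \<Phi> * inv_mat \<Omega>)"
proof -
  let ?V = "inv_mat (Theta T \<theta>)" and ?K = "Kmat T \<theta>" and ?Z = "residuals T k p X \<mu> \<Phi>"
  have "?Z\<^sup>T * ?V\<^sup>T * ?K * ?V * ?Z = ?Z\<^sup>T * prec_mat T \<theta> * ?Z"
    using inv_Theta[OF T, of \<theta>] Kmat_carrier[OF T, of \<theta>] residuals_carrier[of T k p X \<mu> \<Phi>]
    by (simp add: inv_Sigma_mat[OF T] mult_mat_assoc_dim del: assoc_mult_mat)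
  thus ?thesis by (simp add: log_lik_def Let_def det_Sigma_mat[OF T])
qed

end

section \<open>Dividing \<open>Sigma_mat\<close> by a positive scalar\<close>

context
  fixes T k p :: nat and \<theta> \<theta>' :: "real ^ 'q::{finite,linorder}" and X :: "nat \<Rightarrow> real vec" and s :: real
  assumes T: "CARD('q) \<le> T"
    and full_rank: "vec_space.rank T (X_lag T k p X) = 1 + p * k"
    and s: "s > 0"
    and Sigma_scaled: "Sigma_mat T \<theta>' = inverse s \<cdot>\<^sub>m Sigma_mat T \<theta>"
begin

lemma prec_mat_scaled: "prec_mat T \<theta>' = s \<cdot>\<^sub>m prec_mat T \<theta>"
  unfolding Sigma_scaled using s
  by (subst inv_mat_smult[OF Sigma_mat_carrier[OF T] positive_definite_det[OF Sigma_mat_pd[OF T]]]) auto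

lemma prec_mat_form_scaled:
  assumes "dim_row A = T" "dim_row B = T"
  shows "A\<^sup>T * prec_mat T \<theta>' * B = s \<cdot>\<^sub>m (A\<^sup>T * prec_mat T \<theta> * B)"
  unfolding prec_mat_scaled using assms prec_mat_carrier[OF T full_rank, of \<theta>]
  by (simp add: smult_mult_left_dim smult_mult_right_dim)

lemma inv_Gram_scaled:
  "inv_mat ((X_lag T k p X)\<^sup>T * prec_mat T \<theta>' * X_lag T k p X)
     = inverse s \<cdot>\<^sub>m inv_mat ((X_lag T k p X)\<^sup>T * prec_mat T \<theta> * X_lag T k p X)"
proof -
  have "dim_row (X_lag T k p X) = T" using X_lag_carrier by blast
  from prec_mat_form_scaled[OF this this] show ?thesis
    using s by (simp only: inv_mat_smult[OF Gram_carrier[OF T full_rank] positive_definite_det[OF Gram_pd[OF T full_rank]]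
          less_imp_neq[OF s, symmetric]])
qed

lemma mu_Phi_opt_scaled: "mu_Phi_opt T k p X \<theta>' = mu_Phi_opt T k p X \<theta>"
proof -
  have dims: "dim_row (X_lag T k p X) = T" "dim_row (lagged T k p X 0) = T" "dim_col (X_lag T k p X) = 1 + p * k"
    using X_lag_carrier lagged_carrier by blast+
  show ?thesis
    unfolding mu_Phi_opt_eq[OF T full_rank] inv_Gram_scaled prec_mat_form_scaled[OF dims(1,2)]
    using inv_Gram(1)[OF T full_rank, of \<theta>] s dims
    by (simp add: smult_mult_left_dim smult_mult_right_dim smult_smult_mat del: assoc_mult_mat)
qed

lemma Omega_opt_scaled: "Omega_opt T k p X \<theta>' = s \<cdot>\<^sub>m Omega_opt T k p X \<theta>"
proof -
  let ?W = "X_lag T k p X" and ?Y = "lagged T k p X 0" and ?P = "prec_mat T \<theta>"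
  have dims: "dim_row ?W = T" "dim_row ?Y = T" "dim_col ?W = 1 + p * k" "dim_col ?Y = k"
    using X_lag_carrier lagged_carrier by blast+
  \<comment> \<open>The outer factors carry s each and the inverse Gram matrix carries 1/s, so the
    correction term is multiplied by s, exactly like the main term.\<close>
  have *: "a \<cdot>\<^sub>m (s \<cdot>\<^sub>m A - s \<cdot>\<^sub>m B * (inverse s \<cdot>\<^sub>m G) * (s \<cdot>\<^sub>m C)) = s \<cdot>\<^sub>m (a \<cdot>\<^sub>m (A - B * G * C))"
    if "A \<in> carrier_mat k k" "B \<in> carrier_mat k m" "G \<in> carrier_mat m m" "C \<in> carrier_mat m k"
    for a m and A B G C :: "real mat"
  proof -
    have "s \<cdot>\<^sub>m B * (inverse s \<cdot>\<^sub>m G) * (s \<cdot>\<^sub>m C) = s \<cdot>\<^sub>m (B * G * C)"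
      using that s by (simp add: smult_mult_left_dim smult_mult_right_dim smult_smult_mat del: assoc_mult_mat)
    moreover have "a \<cdot>\<^sub>m (s \<cdot>\<^sub>m A - s \<cdot>\<^sub>m D) = s \<cdot>\<^sub>m (a \<cdot>\<^sub>m (A - D))" if "D \<in> carrier_mat k k" for D
      using that \<open>A \<in> carrier_mat k k\<close> by (intro eq_matI) (auto simp: algebra_simps)
    moreover have "B * G * C \<in> carrier_mat k k" using that by auto
    ultimately show ?thesis by (simp only:)
  qed
  show ?thesis
    unfolding Omega_opt_eq[OF T full_rank] inv_Gram_scaled prec_mat_form_scaled[OF dims(1,2)]
      prec_mat_form_scaled[OF dims(2,2)] prec_mat_form_scaled[OF dims(2,1)]
    by (rule *[OF _ _ inv_Gram(1)[OF T full_rank]]) (use dims in \<open>auto intro!: carrier_matI\<close>)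
qed

text \<open>The exponent is T rather than q because the determinant is transferred to the T x T
  matrix \<open>Sigma_mat\<close>.\<close>

lemma det_Kbar_scaled: "det (Kbar T \<theta>') = inverse (s ^ T) * det (Kbar T \<theta>)"
  unfolding det_Sigma_mat[OF T, symmetric] Sigma_scaled
  using Sigma_mat_carrier[OF T, of \<theta>] by (simp add: power_inverse)

text \<open>The determinant of \<Omega> contributes k ln s with weight -T/2, that of
  \<open>Sigma_mat\<close> contributes -T ln s with weight -k/2, and the two cancel. In the trace, s
  from the precision matrix meets 1/s from the inverse of \<Omega>.\<close>

lemma log_lik_scaled:
  assumes "positive_definite k \<Omega>"
  shows "log_lik T k p X \<theta>' \<mu> \<Phi> (s \<cdot>\<^sub>m \<Omega>) = log_lik T k p X \<theta> \<mu> \<Phi> \<Omega>"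
proof -
  let ?Z = "residuals T k p X \<mu> \<Phi>"
  have d: "det \<Omega> \<noteq> 0" and c: "\<Omega> \<in> carrier_mat k k"
    using assms positive_definite_det by (auto simp: positive_definite_def)
  have dK: "det (Kbar T \<theta>) \<noteq> 0" by (rule positive_definite_det[OF Kbar_pd[OF T]])
  have Z: "dim_row ?Z = T" "dim_col ?Z = k" using residuals_carrier by blast+
  have "?Z\<^sup>T * prec_mat T \<theta>' * ?Z * inv_mat (s \<cdot>\<^sub>m \<Omega>) = ?Z\<^sup>T * prec_mat T \<theta> * ?Z * inv_mat \<Omega>"
    unfolding inv_mat_smult[OF c d s[THEN less_imp_neq, symmetric]] prec_mat_form_scaled[OF Z(1,1)]
    using inv_mat(1)[OF c d] s Z
    by (simp add: smult_mult_left_dim smult_mult_right_dim smult_smult_mat del: assoc_mult_mat)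
  moreover have "ln (det (s \<cdot>\<^sub>m \<Omega>)) = real k * ln s + ln (det \<Omega>)"
    using c d s by (simp add: ln_mult ln_realpow mult.commute)
  moreover have "ln (det (Sigma_mat T \<theta>')) = - real T * ln s + ln (det (Sigma_mat T \<theta>))"
    unfolding det_Sigma_mat[OF T] det_Kbar_scaled using s dK by (simp add: ln_mult ln_realpow ln_inverse)
  ultimately show ?thesis
    unfolding log_lik_eq[OF T full_rank] by (simp only:) (simp add: field_simps)
qed

lemma profile_log_lik_scaled:
  assumes "det (Omega_opt T k p X \<theta>) \<noteq> 0"
  shows "profile_log_lik T k p X \<theta>' = profile_log_lik T k p X \<theta>"
proof -
  have dK: "det (Kbar T \<theta>) \<noteq> 0" by (rule positive_definite_det[OF Kbar_pd[OF T]])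
  have "ln (det (Omega_opt T k p X \<theta>')) = real k * ln s + ln (det (Omega_opt T k p X \<theta>))"
    unfolding Omega_opt_scaled using Omega_opt_carrier[OF T full_rank, of \<theta>] assms s
    by (simp add: ln_mult ln_realpow)
  moreover have "ln (det (Kbar T \<theta>')) = - real T * ln s + ln (det (Kbar T \<theta>))"
    unfolding det_Kbar_scaled using s dK by (simp add: ln_mult ln_realpow ln_inverse)
  ultimately show ?thesis
    unfolding profile_log_lik_def by (simp only:) (simp add: field_simps)
qed

end

section \<open>Polynomials and autocovariances\<close>

lemma coeff_ma_poly: "coeff (ma_poly \<theta>) i = complex_of_real (ma_coeff \<theta> i)"
  for \<theta> :: "real ^ 'q::{finite,linorder}"
  by (auto simp: ma_poly_def coeff_sum sum.delta)

lemma degree_ma_poly_le: "degree (ma_poly \<theta>) \<le> CARD('q)"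
  for \<theta> :: "real ^ 'q::{finite,linorder}"
  by (rule degree_le) (simp add: coeff_ma_poly)

text \<open>Inverse of the increasing enumeration of the index type; the enumeration starts at 0 and
  lags at 1, whence the \<open>Suc\<close>.\<close>

definition lag_index :: "'q::{finite,linorder} \<Rightarrow> nat" where
  "lag_index x = Suc (the_inv_into {..<CARD('q)} ((!) (sorted_list_of_set (UNIV :: 'q set))) x)"

lemma bij_sorted_nth: "bij_betw ((!) (sorted_list_of_set (UNIV :: 'q set))) {..<CARD('q)} (UNIV :: 'q::{finite,linorder} set)"
  by (rule bij_betw_nth) auto

lemma lag_index_le: "lag_index (x :: 'q::{finite,linorder}) \<le> CARD('q)"
  using the_inv_into_into[OF bij_betw_imp_inj_on[OF bij_sorted_nth[where 'q = 'q]], of x "{..<CARD('q)}"]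
    bij_sorted_nth[where 'q = 'q]
  by (auto simp: lag_index_def bij_betw_def)

lemma vec_nth_eq_ma_coeff: "vec_nth \<theta> x = ma_coeff \<theta> (lag_index x)"
  for \<theta> :: "real ^ 'q::{finite,linorder}"
  using lag_index_le[of x] f_the_inv_into_f_bij_betw[OF bij_sorted_nth[where 'q = 'q], of x]
  by (simp add: ma_coeff_def lag_index_def)

lemma lag_index_sorted_nth:
  "i < CARD('q) \<Longrightarrow> lag_index (sorted_list_of_set (UNIV :: 'q::{finite,linorder} set) ! i) = Suc i"
  using the_inv_into_f_f[OF bij_betw_imp_inj_on[OF bij_sorted_nth[where 'q = 'q]], of i]
  by (simp add: lag_index_def)

lemma ma_poly_inj: "ma_poly \<theta> = ma_poly \<eta> \<Longrightarrow> \<theta> = \<eta>"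
  for \<theta> \<eta> :: "real ^ 'q::{finite,linorder}"
  using coeff_ma_poly[of \<theta>] coeff_ma_poly[of \<eta>]
  by (simp add: Finite_Cartesian_Product.vec_eq_iff vec_nth_eq_ma_coeff)

text \<open>Characterises the polynomials that come from real coefficient vectors; through it an
  inverted polynomial becomes a point of coefficient space.\<close>

lemma ma_poly_vec_lambda:
  fixes p :: "complex poly"
  assumes "\<And>i. coeff p i \<in> \<real>" "coeff p 0 = 1" "degree p \<le> CARD('q)"
  shows "ma_poly (vec_lambda (\<lambda>x :: 'q::{finite,linorder}. Re (coeff p (lag_index x)))) = p"
proof (rule poly_eqI)
  fix i
  show "coeff (ma_poly (vec_lambda (\<lambda>x :: 'q. Re (coeff p (lag_index x))))) i = coeff p i"
    unfolding coeff_ma_poly using assms coeff_eq_0[of p i]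
    by (auto simp: ma_coeff_def lag_index_sorted_nth of_real_Re)
qed

text \<open>Inversion only changes the root vector, so degree, constant term and reversal of
  inverted polynomials are instances of the facts on \<open>factored_poly\<close>.\<close>

lemma inverted_poly_factored:
  fixes \<Lambda> :: "complex ^ 'q::{finite,linorder}"
  shows "inverted_poly \<Lambda> S = factored_poly (vec_lambda (\<lambda>l. if l \<in> S then inverse (vec_nth \<Lambda> l) else vec_nth \<Lambda> l))"
proof -
  have "(\<Prod>l\<in>UNIV. [:1, - vec_nth (vec_lambda (\<lambda>l. if l \<in> S then inverse (vec_nth \<Lambda> l) else vec_nth \<Lambda> l)) l:])
      = (\<Prod>l\<in>-S \<union> S. [:1, - (if l \<in> S then inverse (vec_nth \<Lambda> l) else vec_nth \<Lambda> l):])"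
    by (simp add: Compl_partition2)
  also have "\<dots> = inverted_poly \<Lambda> S"
    unfolding inverted_poly_def
    by (subst prod.union_disjoint) (auto intro!: arg_cong2[of _ _ _ _ "(*)"] prod.cong)
  finally show ?thesis by (simp only: factored_poly_def)
qed

lemma degree_factored_poly_le: "degree (factored_poly \<Lambda>) \<le> CARD('q)"
  for \<Lambda> :: "complex ^ 'q::{finite,linorder}"
  unfolding factored_poly_def
  by (rule order.trans[OF degree_prod_sum_le]) (auto intro: order.trans[OF sum_mono[where g = "\<lambda>_. 1"]])

lemma degree_factored_poly:
  fixes \<Lambda> :: "complex ^ 'q::{finite,linorder}"
  assumes "\<forall>l. vec_nth \<Lambda> l \<noteq> 0"
  shows "degree (factored_poly \<Lambda>) = CARD('q)"
  unfolding factored_poly_def using assms by (subst degree_prod_sum_eq) auto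

lemma coeff_0_factored_poly: "coeff (factored_poly \<Lambda>) 0 = 1"
  for \<Lambda> :: "complex ^ 'q::{finite,linorder}"
  by (simp add: factored_poly_def flip: poly_0_coeff_0 add: poly_prod)

text \<open>The product is L^q \<theta>(L) \<theta>(1/L), so lag l sits at exponent q + l.
  \<open>reflect_poly\<close> reverses at the actual degree, hence the degree must be q.\<close>

lemma coeff_mult_reflect_ma_poly:
  fixes \<theta> :: "real ^ 'q::{finite,linorder}"
  assumes "degree (ma_poly \<theta>) = CARD('q)"
  shows "coeff (ma_poly \<theta> * reflect_poly (ma_poly \<theta>)) (CARD('q) + l) = complex_of_real (acov \<theta> (int l))"
proof -
  let ?q = "CARD('q)" and ?c = "\<lambda>i. complex_of_real (ma_coeff \<theta> i)"
  have "coeff (ma_poly \<theta> * reflect_poly (ma_poly \<theta>)) (?q + l)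
      = (\<Sum>i\<le>?q + l. ?c i * (if ?q + l - i > ?q then 0 else ?c (?q - (?q + l - i))))"
    unfolding coeff_mult coeff_reflect_poly assms coeff_ma_poly ..
  \<comment> \<open>Terms with i < l ask for a coefficient of the reversal beyond q and vanish;
    otherwise q - (q + l - i) = i - l.\<close>
  also have "\<dots> = (\<Sum>i\<in>{l..?q + l}. ?c i * ?c (i - l))"
    by (rule sum.mono_neutral_cong_right) (auto intro!: arg_cong[where f = "\<lambda>j. _ * ?c j"])
  also have "\<dots> = (\<Sum>m\<le>?q. ?c (m + l) * ?c m)"
    by (rule sum.reindex_bij_witness[of _ "\<lambda>m. m + l" "\<lambda>i. i - l"]) auto
  also have "\<dots> = complex_of_real (acov \<theta> (int l))"
    by (subst acov_eq_sum[of ?q]) auto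
  finally show ?thesis .
qed

section \<open>Effect of inverted roots on the autocovariances\<close>

lemma linear_mult_reflect:
  fixes a :: complex
  assumes "a \<noteq> 0"
  shows "[:1, - a:] * reflect_poly [:1, - a:]
    = Polynomial.smult (a\<^sup>2) ([:1, - inverse a:] * reflect_poly [:1, - inverse a:])"
  using assms by (simp add: reflect_poly_pCons power2_eq_square field_simps)

lemma prod_smult: "(\<Prod>i\<in>A. Polynomial.smult (a i) (p i)) = Polynomial.smult (prod a A) (prod p A)"
  for a :: "'i \<Rightarrow> 'a::comm_semiring_1"
  by (induction A rule: infinite_finite_induct) (auto simp: mult_smult_left mult.commute)

lemma factored_poly_mult_reflect:
  fixes \<Lambda> :: "complex ^ 'q::{finite,linorder}"
  assumes "\<forall>l. vec_nth \<Lambda> l \<noteq> 0"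
  shows "factored_poly \<Lambda> * reflect_poly (factored_poly \<Lambda>)
    = Polynomial.smult ((\<Prod>l\<in>S. vec_nth \<Lambda> l)\<^sup>2) (inverted_poly \<Lambda> S * reflect_poly (inverted_poly \<Lambda> S))"
proof -
  define P where "P a = [:1, - a:] * reflect_poly [:1, - a:]" for a :: complex
  let ?a = "\<lambda>l. vec_nth \<Lambda> l"
  have 1: "factored_poly A * reflect_poly (factored_poly A) = (\<Prod>l\<in>UNIV. P (vec_nth A l))"
    for A :: "complex ^ 'q::{finite,linorder}"
    by (simp only: factored_poly_def reflect_poly_prod prod.distrib P_def)
  have "(\<Prod>l\<in>UNIV. P (?a l)) = (\<Prod>l\<in>UNIV. Polynomial.smult (if l \<in> S then (?a l)\<^sup>2 else 1)
      (P (if l \<in> S then inverse (?a l) else ?a l)))"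
  proof (rule prod.cong[OF refl])
    fix l
    have "P (?a l) = Polynomial.smult ((?a l)\<^sup>2) (P (inverse (?a l)))"
      unfolding P_def using assms by (intro linear_mult_reflect) blast
    thus "P (?a l) = Polynomial.smult (if l \<in> S then (?a l)\<^sup>2 else 1) (P (if l \<in> S then inverse (?a l) else ?a l))"
      by (cases "l \<in> S") (simp_all only: if_True if_False smult_1_left)
  qed
  also have "\<dots> = Polynomial.smult (\<Prod>l\<in>UNIV. if l \<in> S then (?a l)\<^sup>2 else 1)
      (\<Prod>l\<in>UNIV. P (if l \<in> S then inverse (?a l) else ?a l))"
    by (rule prod_smult)
  also have "(\<Prod>l\<in>UNIV. if l \<in> S then (?a l)\<^sup>2 else 1) = (\<Prod>l\<in>S. ?a l)\<^sup>2"
    by (simp add: prod.If_cases prod_power_distrib)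
  finally show ?thesis unfolding 1 inverted_poly_factored by simp
qed

lemma acov_0_pos: "acov \<theta> 0 > 0"
  for \<theta> :: "real ^ 'q::{finite,linorder}"
  by (auto simp: acov_def intro!: sum_pos2[of _ 0])

text \<open>The squared product of the chosen roots is real and positive because it is the quotient
  of two lag-zero autocovariances, each at least 1 from the leading coefficient. In this form the
  result applies at \<theta> and at every point of its neighbourhood.\<close>

lemma acov_inverted:
  fixes \<theta> \<theta>' :: "real ^ 'q::{finite,linorder}" and \<Lambda> :: "complex ^ 'q::{finite,linorder}"
  assumes "\<forall>l. vec_nth \<Lambda> l \<noteq> 0" "ma_poly \<theta> = factored_poly \<Lambda>" "ma_poly \<theta>' = inverted_poly \<Lambda> S"
  obtains s where "s > 0" "complex_of_real s = (\<Prod>l\<in>S. vec_nth \<Lambda> l)\<^sup>2" "\<And>l. acov \<theta> l = s * acov \<theta>' l"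
proof -
  let ?c = "(\<Prod>l\<in>S. vec_nth \<Lambda> l)\<^sup>2"
  have d: "degree (ma_poly \<theta>) = CARD('q)" "degree (ma_poly \<theta>') = CARD('q)"
    using assms(1) by (simp_all add: assms(2,3) inverted_poly_factored degree_factored_poly)
  have "complex_of_real (acov \<theta> (int l)) = ?c * complex_of_real (acov \<theta>' (int l))" for l
    unfolding coeff_mult_reflect_ma_poly[OF d(1), symmetric] coeff_mult_reflect_ma_poly[OF d(2), symmetric]
      assms(2,3) factored_poly_mult_reflect[OF assms(1), of S] coeff_smult ..
  moreover have "acov \<eta> l = acov \<eta> (int (nat \<bar>l\<bar>))" for l and \<eta> :: "real ^ 'q::{finite,linorder}"
    by (simp add: acov_def)
  ultimately have c: "complex_of_real (acov \<theta> l) = ?c * complex_of_real (acov \<theta>' l)" for l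
    by metis
  define s where "s = acov \<theta> 0 / acov \<theta>' 0"
  have s: "complex_of_real s = ?c" using c[of 0] acov_0_pos[of \<theta>'] by (simp add: s_def)
  show ?thesis
  proof
    show "s > 0" using acov_0_pos[of \<theta>] acov_0_pos[of \<theta>'] by (simp add: s_def)
    show "acov \<theta> l = s * acov \<theta>' l" for l
      using c[of l] unfolding s[symmetric] of_real_mult[symmetric] of_real_eq_iff .
  qed (rule s)
qed

lemma Sigma_mat_scaled:
  fixes \<theta> \<theta>' :: "real ^ 'q::{finite,linorder}"
  assumes "CARD('q) \<le> T" "s > 0" "\<And>l. acov \<theta> l = s * acov \<theta>' l"
  shows "Sigma_mat T \<theta>' = inverse s \<cdot>\<^sub>m Sigma_mat T \<theta>"
  unfolding Sigma_mat_toeplitz[OF assms(1)] using assms(2,3) by (intro eq_matI) auto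

lemma acov_gf_scaled:
  fixes \<theta> \<theta>' :: "real ^ 'q::{finite,linorder}"
  assumes "\<And>l. acov \<theta> l = s * acov \<theta>' l"
  shows "acov_gf z \<theta>' (s \<cdot>\<^sub>m \<Omega>) = acov_gf z \<theta> \<Omega>"
proof -
  have "(\<Sum>\<^sub>\<infinity>i\<in>UNIV. complex_of_real (acov \<theta> i) * z powi i)
      = complex_of_real s * (\<Sum>\<^sub>\<infinity>i\<in>UNIV. complex_of_real (acov \<theta>' i) * z powi i)"
    unfolding assms by (simp add: mult.assoc infsum_cmult_right')
  thus ?thesis unfolding acov_gf_def by (intro eq_matI) auto
qed

section \<open>Real polynomials\<close>

lemma map_poly_cnj_mult: "map_poly cnj (p * q) = map_poly cnj p * map_poly cnj q"
  by (rule iffD1[OF poly_eq_poly_eq_iff]) auto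

lemma map_poly_cnj_prod: "map_poly cnj (\<Prod>i\<in>A. p i) = (\<Prod>i\<in>A. map_poly cnj (p i))"
  by (induction A rule: infinite_finite_induct) (auto simp: map_poly_cnj_mult)

lemma map_poly_cnj_eq_iff: "map_poly cnj p = p \<longleftrightarrow> (\<forall>i. coeff p i \<in> \<real>)"
  by (auto simp: poly_eq_iff coeff_map_poly Reals_cnj_iff)

text \<open>Conjugation permutes the factors; multisets account for repeated roots. With f left
  abstract, the factors of the roots and of their inverses are treated alike.\<close>

lemma map_poly_cnj_prod_conj_closed:
  assumes "image_mset (\<lambda>l. cnj (a l)) (mset_set S) = image_mset a (mset_set S)"
    and f: "\<And>x. f (cnj x) = map_poly cnj (f x)"
  shows "map_poly cnj (\<Prod>l\<in>S. f (a l)) = (\<Prod>l\<in>S. f (a l))"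
proof -
  have "map_poly cnj (\<Prod>l\<in>S. f (a l)) = (\<Prod>l\<in>S. f (cnj (a l)))"
    by (simp add: map_poly_cnj_prod f)
  also have "\<dots> = prod_mset (image_mset f (image_mset (\<lambda>l. cnj (a l)) (mset_set S)))"
    by (simp add: prod_unfold_prod_mset image_mset.compositionality comp_def)
  also have "\<dots> = (\<Prod>l\<in>S. f (a l))"
    unfolding assms(1) by (simp add: prod_unfold_prod_mset image_mset.compositionality comp_def)
  finally show ?thesis .
qed

text \<open>Closure under conjugation is given for the roots in S only. The cofactor A of the
  remaining roots is real by cancellation: A B and B are real, and B is nonzero since its constant
  term is 1.\<close>

lemma inverted_poly_real:
  fixes \<theta> :: "real ^ 'q::{finite,linorder}" and \<Lambda> :: "complex ^ 'q::{finite,linorder}"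
  assumes fact: "ma_poly \<theta> = factored_poly \<Lambda>"
    and conj_closed: "image_mset (\<lambda>l. cnj (vec_nth \<Lambda> l)) (mset_set S) = image_mset (vec_nth \<Lambda>) (mset_set S)"
  shows "\<exists>\<theta>' :: real ^ 'q::{finite,linorder}. ma_poly \<theta>' = inverted_poly \<Lambda> S"
proof -
  define A where "A = (\<Prod>l\<in>- S. [:1, - vec_nth \<Lambda> l:])"
  define B where "B = (\<Prod>l\<in>S. [:1, - vec_nth \<Lambda> l:])"
  define C where "C = (\<Prod>l\<in>S. [:1, - inverse (vec_nth \<Lambda> l):])"
  have "factored_poly \<Lambda> = (\<Prod>l\<in>- S \<union> S. [:1, - vec_nth \<Lambda> l:])"
    by (simp add: factored_poly_def Compl_partition2)
  hence AB: "factored_poly \<Lambda> = A * B"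
    unfolding A_def B_def by (subst (asm) prod.union_disjoint) auto
  have B: "map_poly cnj B = B" and C: "map_poly cnj C = C"
    unfolding B_def C_def
    using map_poly_cnj_prod_conj_closed[OF conj_closed, of "\<lambda>x. [:1, - x:]"]
      map_poly_cnj_prod_conj_closed[OF conj_closed, of "\<lambda>x. [:1, - inverse x:]"]
    by (simp_all add: map_poly_pCons)
  have "poly B 0 = 1" by (simp add: B_def poly_prod)
  hence "B \<noteq> 0" by auto
  have "map_poly cnj (A * B) = A * B"
    unfolding AB[symmetric] fact[symmetric] map_poly_cnj_eq_iff coeff_ma_poly by simp
  hence "map_poly cnj A = A" using \<open>B \<noteq> 0\<close> by (simp add: map_poly_cnj_mult B)
  hence "map_poly cnj (inverted_poly \<Lambda> S) = inverted_poly \<Lambda> S"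
    using C by (simp add: inverted_poly_def A_def C_def map_poly_cnj_mult)
  hence "ma_poly (vec_lambda (\<lambda>x :: 'q::{finite,linorder}. Re (coeff (inverted_poly \<Lambda> S) (lag_index x)))) = inverted_poly \<Lambda> S"
    unfolding map_poly_cnj_eq_iff
    by (intro ma_poly_vec_lambda) (simp_all add: inverted_poly_factored coeff_0_factored_poly degree_factored_poly_le)
  thus ?thesis by blast
qed

section \<open>The roots as functions of the coefficients\<close>

lemma poly_eq_lag:
  fixes p p' :: "complex poly"
  assumes "coeff p 0 = coeff p' 0" "degree p \<le> CARD('q)" "degree p' \<le> CARD('q)"
    and lag: "\<And>x :: 'q::{finite,linorder}. coeff p (lag_index x) = coeff p' (lag_index x)"
  shows "p = p'"
proof (rule poly_eqI)
  fix i
  consider "i = 0" | "0 < i" "i \<le> CARD('q)" | "i > CARD('q)" by linarith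
  thus "coeff p i = coeff p' i"
  proof cases
    case 2
    thus ?thesis
      using lag[of "sorted_list_of_set UNIV ! (i - 1)"] lag_index_sorted_nth[of "i - 1", where 'q = 'q] by simp
  next
    case 3
    thus ?thesis using assms(2,3) by (simp add: coeff_eq_0)
  qed (use assms(1) in simp)
qed

lemma bij_lag_index: "bij_betw (lag_index :: 'q \<Rightarrow> nat) UNIV {1..CARD('q::{finite,linorder})}"
  unfolding bij_betw_def
proof
  show "inj (lag_index :: 'q \<Rightarrow> nat)"
    using f_the_inv_into_f_bij_betw[OF bij_sorted_nth[where 'q = 'q]]
    by (intro injI) (metis UNIV_I lag_index_def nat.inject)
  show "range (lag_index :: 'q \<Rightarrow> nat) = {1..CARD('q)}"
  proof (intro equalityI subsetI)
    fix n assume "n \<in> {1..CARD('q)}"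
    thus "n \<in> range (lag_index :: 'q \<Rightarrow> nat)" using lag_index_sorted_nth[of "n - 1", where 'q = 'q]
      by (intro image_eqI[of _ _ "sorted_list_of_set UNIV ! (n - 1)"]) auto
  qed (use lag_index_le in \<open>auto simp: lag_index_def\<close>)
qed

lemma poly_factored_poly: "poly (factored_poly \<Lambda>) x = (\<Prod>l\<in>UNIV. 1 - vec_nth \<Lambda> l * x)"
  for \<Lambda> :: "complex ^ 'q::{finite,linorder}"
  by (simp add: factored_poly_def poly_prod mult.commute)

lemma poly_factored_poly_eq_0:
  fixes \<Lambda> :: "complex ^ 'q::{finite,linorder}"
  assumes "a \<noteq> 0"
  shows "poly (factored_poly \<Lambda>) (inverse a) = 0 \<longleftrightarrow> (\<exists>l. vec_nth \<Lambda> l = a)"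
  using assms by (auto simp: poly_factored_poly field_simps)

lemma coeff_linear_mult:
  "coeff ([:1, - a:] * p) n = coeff p n - a * (case n of 0 \<Rightarrow> 0 | Suc m \<Rightarrow> coeff p m)"
  for a :: complex
  by (simp add: coeff_pCons split: nat.split)

lemma continuous_on_coeff_prod_linear:
  fixes a :: "'i \<Rightarrow> 'a::topological_space \<Rightarrow> complex"
  assumes "finite A" "\<And>i. i \<in> A \<Longrightarrow> continuous_on X (a i)"
  shows "continuous_on X (\<lambda>y. coeff (\<Prod>i\<in>A. [:1, - a i y:]) n)"
  using assms
proof (induction A arbitrary: n rule: finite_induct)
  case (insert i A)
  show ?case unfolding prod.insert[OF insert.hyps] coeff_linear_mult
    using insert by (cases n) (auto intro!: continuous_intros)
qed auto

lemma differentiable_coeff_prod_linear: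
  fixes a :: "'i \<Rightarrow> 'a::real_normed_vector \<Rightarrow> complex"
  assumes "finite A" "\<And>i. i \<in> A \<Longrightarrow> a i differentiable (at x)"
  shows "(\<lambda>y. coeff (\<Prod>i\<in>A. [:1, - a i y:]) n) differentiable (at x)"
  using assms
proof (induction A arbitrary: n rule: finite_induct)
  case (insert i A)
  show ?case unfolding prod.insert[OF insert.hyps] coeff_linear_mult
    using insert by (cases n) (auto intro!: differentiable_diff differentiable_mult)
qed auto

text \<open>Caratheodory's criterion: the slopes \<open>K i\<close> need only be continuous at x.
  The error of the i-th summand is the i-th component of y - x times \<open>K i y - K i x\<close>,
  which is o(|y - x|).\<close>

lemma differentiable_caratheodory:
  fixes f :: "real ^ 'q \<Rightarrow> complex" and K :: "'q::finite \<Rightarrow> real ^ 'q \<Rightarrow> complex"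
  assumes f: "\<And>y. y \<in> U \<Longrightarrow> f y = f x + (\<Sum>i\<in>UNIV. (vec_nth y i - vec_nth x i) *\<^sub>R K i y)"
    and U: "open U" "x \<in> U"
    and K: "\<And>i. (K i \<longlongrightarrow> K i x) (at x)"
  shows "f differentiable (at x)"
proof -
  have "((\<lambda>y. (vec_nth y i - vec_nth x i) *\<^sub>R K i y) has_derivative (\<lambda>h. vec_nth h i *\<^sub>R K i x)) (at x)" for i
    unfolding has_derivative_iff_norm
  proof
    show "bounded_linear (\<lambda>h. vec_nth h i *\<^sub>R K i x)"
      by (intro bounded_linear_scaleR_left[THEN bounded_linear_compose] bounded_linear_vec_nth)
    have "((\<lambda>y. norm (K i y - K i x)) \<longlongrightarrow> 0) (at x)"
      using K[of i] LIM_zero tendsto_norm_zero by blast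
    then show "((\<lambda>y. norm ((vec_nth y i - vec_nth x i) *\<^sub>R K i y - (vec_nth x i - vec_nth x i) *\<^sub>R K i x
        - vec_nth (y - x) i *\<^sub>R K i x) / norm (y - x)) \<longlongrightarrow> 0) (at x)"
    proof (rule Lim_null_comparison[rotated], intro eventuallyI)
      fix y
      have "(vec_nth y i - vec_nth x i) *\<^sub>R K i y - vec_nth (y - x) i *\<^sub>R K i x
          = vec_nth (y - x) i *\<^sub>R (K i y - K i x)"
        by (simp add: scaleR_diff_right)
      moreover have "\<bar>vec_nth (y - x) i\<bar> * norm (K i y - K i x) \<le> norm (y - x) * norm (K i y - K i x)"
        by (intro mult_right_mono component_le_norm_cart) auto
      ultimately show "norm (norm ((vec_nth y i - vec_nth x i) *\<^sub>R K i y - (vec_nth x i - vec_nth x i) *\<^sub>R K i x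
        - vec_nth (y - x) i *\<^sub>R K i x) / norm (y - x)) \<le> norm (K i y - K i x)"
        by (cases "y = x") (auto simp: divide_simps mult.commute)
    qed
  qed
  hence "((\<lambda>y. f x + (\<Sum>i\<in>UNIV. (vec_nth y i - vec_nth x i) *\<^sub>R K i y)) has_derivative
      (\<lambda>h. 0 + (\<Sum>i\<in>UNIV. vec_nth h i *\<^sub>R K i x))) (at x)"
    by (intro has_derivative_add has_derivative_const has_derivative_sum) auto
  hence "(f has_derivative (\<lambda>h. 0 + (\<Sum>i\<in>UNIV. vec_nth h i *\<^sub>R K i x))) (at x)"
    by (rule has_derivative_transform_within_open[OF _ U]) (simp add: f)
  thus ?thesis unfolding differentiable_def by blast
qed

text \<open>The polynomial x^q \<theta>(1/x) has the \<lambda>'s themselves as roots, is monic, and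
  is affine in the coefficients; so subtracting two such equations leaves a linear expression in
  their difference.\<close>

lemma reversed_ma_poly:
  fixes \<theta> :: "real ^ 'q::{finite,linorder}" and \<Lambda> :: "complex ^ 'q::{finite,linorder}"
  assumes "x \<noteq> 0" "ma_poly \<theta> = factored_poly \<Lambda>"
  shows "(\<Prod>l\<in>UNIV. x - vec_nth \<Lambda> (l :: 'q))
    = x ^ CARD('q) + (\<Sum>i\<in>UNIV. of_real (vec_nth \<theta> i) * x ^ (CARD('q) - lag_index i))"
proof -
  let ?q = "CARD('q)"
  have "(\<Prod>l\<in>UNIV. x - vec_nth \<Lambda> l) = (\<Prod>l\<in>UNIV. x * (1 - vec_nth \<Lambda> l * inverse x))"
    using assms(1) by (intro prod.cong) (auto simp: field_simps)
  also have "\<dots> = x ^ ?q * poly (ma_poly \<theta>) (inverse x)"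
    by (simp add: prod.distrib assms(2) poly_factored_poly)
  also have "\<dots> = (\<Sum>i\<le>?q. of_real (ma_coeff \<theta> i) * (x ^ ?q * inverse x ^ i))"
    by (simp add: ma_poly_def poly_sum poly_monom sum_distrib_left mult_ac)
  also have "\<dots> = (\<Sum>i\<le>?q. of_real (ma_coeff \<theta> i) * x ^ (?q - i))"
    using assms(1) by (intro sum.cong) (auto simp: power_diff field_simps)
  also have "\<dots> = x ^ ?q + (\<Sum>i\<in>{1..?q}. of_real (ma_coeff \<theta> i) * x ^ (?q - i))"
    by (simp add: sum.atMost_shift sum.atLeast1_atMost_eq)
  also have "(\<Sum>i\<in>{1..?q}. of_real (ma_coeff \<theta> i) * x ^ (?q - i))
      = (\<Sum>i\<in>UNIV. of_real (ma_coeff \<theta> (lag_index i)) * x ^ (?q - lag_index (i :: 'q)))"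
    by (rule sum.reindex_bij_betw[OF bij_lag_index, symmetric])
  finally show ?thesis by (simp add: vec_nth_eq_ma_coeff)
qed

text \<open>With \<open>H(x) = \<Prod>\<^sub>m\<^sub>\<noteq>\<^sub>l (x - \<lambda>\<^sub>m)\<close>, subtracting the equations of the root \<open>\<Lambda>(\<eta>)\<^sub>l\<close> for \<open>\<eta>\<close> and \<open>\<theta>\<close>
  gives \<open>(\<Lambda>(\<eta>)\<^sub>l - \<lambda>\<^sub>l) H(\<Lambda>(\<eta>)\<^sub>l) = - \<Sum>\<^sub>i (\<eta>\<^sub>i - \<theta>\<^sub>i) \<Lambda>(\<eta>)\<^sub>l\<^sup>q\<^sup>-\<^sup>i\<close>, and \<open>H(\<lambda>\<^sub>l) \<noteq> 0\<close>.\<close>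

lemma root_differentiable:
  fixes \<theta> :: "real ^ 'q::{finite,linorder}" and \<Lambda> :: "real ^ 'q::{finite,linorder} \<Rightarrow> complex ^ 'q::{finite,linorder}"
  assumes U: "open U" "\<theta> \<in> U" and cont: "continuous_on U \<Lambda>"
    and root: "\<And>\<eta> l. \<eta> \<in> U \<Longrightarrow> vec_nth (\<Lambda> \<eta>) l \<noteq> 0" "\<And>\<eta>. \<eta> \<in> U \<Longrightarrow> ma_poly \<eta> = factored_poly (\<Lambda> \<eta>)"
    and inj: "inj (vec_nth (\<Lambda> \<theta>))"
  shows "(\<lambda>\<eta>. vec_nth (\<Lambda> \<eta>) l) differentiable (at \<theta>)"
proof -
  let ?q = "CARD('q)"
  define a where "a \<eta> = vec_nth (\<Lambda> \<eta>) l" for \<eta>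
  define H where "H x = (\<Prod>m\<in>UNIV - {l}. x - vec_nth (\<Lambda> \<theta>) m)" for x
  have Hc: "continuous_on UNIV H" unfolding H_def by (intro continuous_intros)
  have ac: "continuous_on U a" unfolding a_def by (intro continuous_intros cont)
  \<comment> \<open>The neighbourhood is shrunk so that one may divide by H at the moving root; H is
    nonzero at \<theta> because the root is simple.\<close>
  have HU: "open {\<eta>\<in>U. H (a \<eta>) \<noteq> 0}"
  proof -
    have "continuous_on U (\<lambda>\<eta>. H (a \<eta>))"
      using continuous_on_compose2[OF Hc ac] by auto
    from continuous_open_preimage[OF this U(1), of "- {0}"] show ?thesis
      by (simp add: Int_def vimage_def open_Compl)
  qed
  have nz: "H (a \<theta>) \<noteq> 0" using inj by (auto simp: H_def a_def inj_def)
  show ?thesis unfolding a_def[symmetric]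
  proof (rule differentiable_caratheodory[OF _ HU])
    fix \<eta> assume "\<eta> \<in> {\<eta>\<in>U. H (a \<eta>) \<noteq> 0}"
    hence \<eta>: "\<eta> \<in> U" "H (a \<eta>) \<noteq> 0" by auto
    have a0: "a \<eta> \<noteq> 0" using root(1)[OF \<eta>(1)] by (simp add: a_def)
    have "(a \<eta> - a \<theta>) * H (a \<eta>) = (\<Prod>m\<in>UNIV. a \<eta> - vec_nth (\<Lambda> \<theta>) m)"
      unfolding H_def a_def[of \<theta>] by (rule prod.remove[symmetric]) auto
    also have "\<dots> = a \<eta> ^ ?q + (\<Sum>i\<in>UNIV. of_real (vec_nth \<theta> i) * a \<eta> ^ (?q - lag_index i))"
      by (rule reversed_ma_poly[OF a0 root(2)[OF U(2)]])
    finally have 1: "(a \<eta> - a \<theta>) * H (a \<eta>) = \<dots>" .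
    have "0 = (\<Prod>m\<in>UNIV. a \<eta> - vec_nth (\<Lambda> \<eta>) m)" unfolding a_def by (auto intro: exI[of _ l])
    also have "\<dots> = a \<eta> ^ ?q + (\<Sum>i\<in>UNIV. of_real (vec_nth \<eta> i) * a \<eta> ^ (?q - lag_index i))"
      by (rule reversed_ma_poly[OF a0 root(2)[OF \<eta>(1)]])
    finally have "(a \<eta> - a \<theta>) * H (a \<eta>) = - (\<Sum>i\<in>UNIV. (vec_nth \<eta> i - vec_nth \<theta> i) *\<^sub>R a \<eta> ^ (?q - lag_index i))"
      unfolding 1 by (simp add: scaleR_conv_of_real left_diff_distrib sum_subtractf eq_neg_iff_add_eq_0 add_ac)
    hence "a \<eta> - a \<theta> = - (\<Sum>i\<in>UNIV. (vec_nth \<eta> i - vec_nth \<theta> i) *\<^sub>R a \<eta> ^ (?q - lag_index i)) / H (a \<eta>)"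
      using \<eta>(2) by (simp add: field_simps)
    also have "\<dots> = (\<Sum>i\<in>UNIV. (vec_nth \<eta> i - vec_nth \<theta> i) *\<^sub>R (- (a \<eta> ^ (?q - lag_index i)) / H (a \<eta>)))"
      by (simp add: sum_divide_distrib sum_negf scaleR_conv_of_real)
    finally show "a \<eta> = a \<theta> + (\<Sum>i\<in>UNIV. (vec_nth \<eta> i - vec_nth \<theta> i) *\<^sub>R (- (a \<eta> ^ (?q - lag_index i)) / H (a \<eta>)))"
      by (simp add: algebra_simps)
  next
    show "\<theta> \<in> {\<eta>\<in>U. H (a \<eta>) \<noteq> 0}" using U nz by simp
    have at: "(a \<longlongrightarrow> a \<theta>) (at \<theta>)" using ac U by (simp add: continuous_on_eq_continuous_at isCont_def)
    have "((\<lambda>\<eta>. H (a \<eta>)) \<longlongrightarrow> H (a \<theta>)) (at \<theta>)"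
      unfolding H_def by (intro tendsto_intros at)
    thus "((\<lambda>\<eta>. - (a \<eta> ^ (?q - lag_index i)) / H (a \<eta>)) \<longlongrightarrow> - (a \<theta> ^ (?q - lag_index i)) / H (a \<theta>)) (at \<theta>)" for i :: 'q
      by (intro tendsto_intros at nz)
  qed
qed

text \<open>The components of F are real parts of polynomials in the roots and inverse roots, which
  are differentiable at \<theta>. F is prescribed on U only, so the derivative is transferred along
  equality on an open set.\<close>

lemma local_IR_differentiable:
  fixes \<theta> :: "real ^ 'q::{finite,linorder}" and lam :: "complex ^ 'q::{finite,linorder}"
  assumes IR: "local_IR \<theta> lam S U F" and inj: "inj (vec_nth lam)"
  shows "F differentiable (at \<theta>)"
proof -
  obtain \<Lambda> where U: "open U" "\<theta> \<in> U" and cont: "continuous_on U \<Lambda>" and [simp]: "\<Lambda> \<theta> = lam"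
    and \<Lambda>: "\<And>\<eta> l. \<eta> \<in> U \<Longrightarrow> vec_nth (\<Lambda> \<eta>) l \<noteq> 0" "\<And>\<eta>. \<eta> \<in> U \<Longrightarrow> ma_poly \<eta> = factored_poly (\<Lambda> \<eta>)"
      "\<And>\<eta>. \<eta> \<in> U \<Longrightarrow> ma_poly (F \<eta>) = inverted_poly (\<Lambda> \<eta>) S"
    using IR unfolding local_IR_def by metis
  have dr: "(\<lambda>\<eta>. vec_nth (\<Lambda> \<eta>) l) differentiable (at \<theta>)" for l
    using root_differentiable[OF U cont \<Lambda>(1,2)] inj by simp
  define a where "a l \<eta> = (if l \<in> S then inverse (vec_nth (\<Lambda> \<eta>) l) else vec_nth (\<Lambda> \<eta>) l)" for l \<eta>
  have da: "a l differentiable (at \<theta>)" for l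
    using dr[of l] \<Lambda>(1)[OF U(2), of l] unfolding a_def by (cases "l \<in> S") (auto intro!: differentiable_inverse)
  have F: "vec_nth (F \<eta>) x = Re (coeff (\<Prod>l\<in>UNIV. [:1, - a l \<eta>:]) (lag_index x))" if "\<eta> \<in> U" for \<eta> x
  proof -
    have "complex_of_real (vec_nth (F \<eta>) x) = coeff (inverted_poly (\<Lambda> \<eta>) S) (lag_index x)"
      by (simp add: vec_nth_eq_ma_coeff flip: coeff_ma_poly \<Lambda>(3)[OF that])
    also have "\<dots> = coeff (\<Prod>l\<in>UNIV. [:1, - a l \<eta>:]) (lag_index x)"
      by (simp add: inverted_poly_factored factored_poly_def a_def)
    finally show ?thesis by (metis Re_complex_of_real)
  qed
  have "(\<lambda>\<eta>. vec_nth (F \<eta>) x) differentiable (at \<theta>)" for x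
  proof -
    have "(\<lambda>\<eta>. coeff (\<Prod>l\<in>UNIV. [:1, - a l \<eta>:]) (lag_index x)) differentiable (at \<theta>)"
      by (rule differentiable_coeff_prod_linear) (auto intro: da)
    hence "(\<lambda>\<eta>. Re (coeff (\<Prod>l\<in>UNIV. [:1, - a l \<eta>:]) (lag_index x))) differentiable (at \<theta>)"
      by (rule differentiable_compose[OF bounded_linear_imp_differentiable[OF bounded_linear_Re]])
    then obtain D where "((\<lambda>\<eta>. Re (coeff (\<Prod>l\<in>UNIV. [:1, - a l \<eta>:]) (lag_index x))) has_derivative D) (at \<theta>)"
      unfolding differentiable_def by blast
    hence "((\<lambda>\<eta>. vec_nth (F \<eta>) x) has_derivative D) (at \<theta>)"
      by (rule has_derivative_transform_within_open[OF _ U]) (simp add: F)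
    thus ?thesis unfolding differentiable_def by blast
  qed
  thus ?thesis
    by (subst differentiable_componentwise_within) (auto simp: Basis_vec_def inner_axis)
qed

section \<open>Existence of a continuous labelling of the roots\<close>

lemma uniform_separation:
  fixes a :: "'i::finite \<Rightarrow> complex"
  assumes "inj a" "\<And>i. a i \<noteq> 0"
  obtains r where "r > 0" "\<And>i. r \<le> norm (a i)" "\<And>i j. i \<noteq> j \<Longrightarrow> 2 * r \<le> dist (a i) (a j)"
proof -
  \<comment> \<open>Halved distances make the discs of radius r about the points disjoint; the
    moduli keep 0 outside them.\<close>
  define D where "D = insert 1 (range (\<lambda>i. norm (a i)) \<union> (\<lambda>(i, j). dist (a i) (a j) / 2) ` {(i, j). i \<noteq> j})"
  have fin: "finite D" "D \<noteq> {}" by (auto simp: D_def)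
  have "Min D > 0" unfolding Min_gr_iff[OF fin] using assms by (auto simp: D_def inj_def)
  moreover have "Min D \<le> norm (a i)" for i by (rule Min_le[OF fin(1)]) (auto simp: D_def)
  moreover have "Min D \<le> dist (a i) (a j) / 2" if "i \<noteq> j" for i j
    by (rule Min_le[OF fin(1)]) (use that in \<open>auto simp: D_def\<close>)
  ultimately show ?thesis using that[of "Min D"] by fastforce
qed

text \<open>Invariance of domain is applied to the coefficient map G on a ball of complex root
  vectors; real coefficient vectors enter afterwards through the embedding e, and U is the preimage
  under e. The remaining work is to show that the inverted polynomial stays real at every point of
  U.\<close>

lemma local_IR_exists:
  fixes \<theta> :: "real ^ 'q::{finite,linorder}" and lam :: "complex ^ 'q::{finite,linorder}"
  assumes fact: "ma_poly \<theta> = factored_poly lam"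
    and nz: "\<forall>l. vec_nth lam l \<noteq> 0"
    and conj_closed: "image_mset (\<lambda>l. cnj (vec_nth lam l)) (mset_set S) = image_mset (vec_nth lam) (mset_set S)"
    and inj: "inj (vec_nth lam)"
  shows "\<exists>U F. local_IR \<theta> lam S U F"
proof -
  obtain r where r: "r > 0" "\<And>l. r \<le> norm (vec_nth lam l)"
    "\<And>l m. l \<noteq> m \<Longrightarrow> 2 * r \<le> dist (vec_nth lam l) (vec_nth lam m)"
    using uniform_separation[OF inj] nz by metis
  define B where "B = ball lam r"
  have comp: "dist (vec_nth \<Lambda> l) (vec_nth lam l) < r" if "\<Lambda> \<in> B" for \<Lambda> l
    using that order.strict_trans1[OF dist_vec_nth_le, of \<Lambda> lam r l] by (simp add: B_def dist_commute)
  \<comment> \<open>Disjointness of the discs: closeness to a root determines its label.\<close>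
  have near: "l = m" if "dist x (vec_nth lam l) < r" "dist x (vec_nth lam m) < r" for x l m
    using r(3)[of l m] that dist_triangle2[of "vec_nth lam l" "vec_nth lam m" x]
    by (auto simp: dist_commute)
  have Bnz: "vec_nth \<Lambda> l \<noteq> 0" if "\<Lambda> \<in> B" for \<Lambda> l
    using comp[OF that, of l] r(2)[of l] by (auto simp: dist_norm)
  have Binj: "inj (vec_nth \<Lambda>)" if "\<Lambda> \<in> B" for \<Lambda>
    using comp[OF that] near by (metis injI)
  define G where "G \<Lambda> = vec_lambda (\<lambda>x :: 'q. coeff (factored_poly \<Lambda>) (lag_index x))" for \<Lambda> :: "complex ^ 'q::{finite,linorder}"
  have G_eq: "factored_poly \<Lambda> = p" if "\<And>x :: 'q. vec_nth (G \<Lambda>) x = coeff p (lag_index x)" "coeff p 0 = 1" "degree p \<le> CARD('q)" for \<Lambda> p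
    using that by (intro poly_eq_lag[where 'q = 'q]) (auto simp: G_def coeff_0_factored_poly degree_factored_poly_le)
  have contG: "continuous_on B G"
    unfolding G_def factored_poly_def
    by (intro continuous_on_vec_lambda continuous_on_coeff_prod_linear continuous_intros) auto
  \<comment> \<open>The coefficients determine the set of roots, and the discs then determine the
    labelling.\<close>
  have injG: "inj_on G B"
  proof (rule inj_onI)
    fix A A' assume A: "A \<in> B" "A' \<in> B" "G A = G A'"
    have eq: "factored_poly A = factored_poly A'"
      by (rule G_eq) (use A(3) in \<open>auto simp: G_def coeff_0_factored_poly degree_factored_poly_le\<close>)
    have "vec_nth A l = vec_nth A' l" for l
    proof -
      have "poly (factored_poly A') (inverse (vec_nth A l)) = 0"
        unfolding eq[symmetric] poly_factored_poly_eq_0[OF Bnz[OF A(1)]] by blast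
      then obtain m where m: "vec_nth A' m = vec_nth A l"
        unfolding poly_factored_poly_eq_0[OF Bnz[OF A(1)]] by blast
      have "l = m" using near[of "vec_nth A l" l m] comp[OF A(1), of l] comp[OF A(2), of m] m by simp
      thus ?thesis using m by simp
    qed
    thus "A = A'" by (simp add: Finite_Cartesian_Product.vec_eq_iff)
  qed
  have "open B" by (simp add: B_def)
  obtain g where g: "homeomorphism B (G ` B) G g"
    using invariance_of_domain_homeomorphism[OF \<open>open B\<close> contG order_refl injG] .
  have openGB: "open (G ` B)" by (rule invariance_of_domain[OF contG \<open>open B\<close> injG])
  define e :: "real ^ 'q::{finite,linorder} \<Rightarrow> complex ^ 'q::{finite,linorder}" where
    "e \<eta> = vec_lambda (\<lambda>x. complex_of_real (vec_nth \<eta> x))" for \<eta>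
  have conte: "continuous_on UNIV e" unfolding e_def by (intro continuous_intros continuous_on_vec_lambda)
  define U where "U = e -` (G ` B)"
  define \<Lambda> where "\<Lambda> \<eta> = g (e \<eta>)" for \<eta>
  have openU: "open U" unfolding U_def by (rule open_vimage[OF openGB conte])
  have "lam \<in> B" using r by (simp add: B_def)
  have Glam: "G lam = e \<theta>"
    unfolding G_def fact[symmetric] e_def coeff_ma_poly vec_nth_eq_ma_coeff ..
  have "\<theta> \<in> U" using Glam \<open>lam \<in> B\<close> unfolding U_def by (metis image_eqI vimageI)
  have \<Lambda>\<theta>: "\<Lambda> \<theta> = lam"
    unfolding \<Lambda>_def Glam[symmetric] using homeomorphism_apply1[OF g \<open>lam \<in> B\<close>] .
  have cont\<Lambda>: "continuous_on U \<Lambda>"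
    unfolding \<Lambda>_def
    by (rule continuous_on_compose2[OF homeomorphism_cont2[OF g] continuous_on_subset[OF conte]]) (auto simp: U_def)
  have \<Lambda>B: "\<Lambda> \<eta> \<in> B" and G\<Lambda>: "G (\<Lambda> \<eta>) = e \<eta>" if "\<eta> \<in> U" for \<eta>
    using that homeomorphism_image2[OF g] homeomorphism_apply2[OF g, of "e \<eta>"] by (auto simp: U_def \<Lambda>_def)
  have fact\<Lambda>: "ma_poly \<eta> = factored_poly (\<Lambda> \<eta>)" if "\<eta> \<in> U" for \<eta>
    by (rule G_eq[symmetric]) (auto simp: G\<Lambda>[OF that] e_def coeff_ma_poly vec_nth_eq_ma_coeff degree_ma_poly_le)
  have "\<exists>\<eta>' :: real ^ 'q::{finite,linorder}. ma_poly \<eta>' = inverted_poly (\<Lambda> \<eta>) S" if \<eta>: "\<eta> \<in> U" for \<eta>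
  proof (rule inverted_poly_real[OF fact\<Lambda>[OF \<eta>]])
    let ?a = "vec_nth (\<Lambda> \<eta>)"
    \<comment> \<open>The conjugate of the root l is a root of the real polynomial at \<eta>. It
      lies within r of the conjugate of the unperturbed root l, which is the unperturbed root m for
      some m in S; hence it carries the label m.\<close>
    have "cnj (?a l) \<in> ?a ` S" if l: "l \<in> S" for l
    proof -
      have "cnj (vec_nth lam l) \<in># image_mset (vec_nth lam) (mset_set S)"
        unfolding conj_closed[symmetric] using l by simp
      then obtain m where m: "m \<in> S" "cnj (vec_nth lam l) = vec_nth lam m" by auto
      have "poly (ma_poly \<eta>) (inverse (?a l)) = 0"
        unfolding fact\<Lambda>[OF \<eta>] poly_factored_poly_eq_0[OF Bnz[OF \<Lambda>B[OF \<eta>]]] by blast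
      hence "poly (ma_poly \<eta>) (inverse (cnj (?a l))) = 0"
        using real_poly_cnj_root_iff[of "ma_poly \<eta>" "inverse (?a l)"] by (simp add: coeff_ma_poly)
      moreover have "cnj (?a l) \<noteq> 0" using Bnz[OF \<Lambda>B[OF \<eta>]] by simp
      ultimately obtain m' where m': "?a m' = cnj (?a l)"
        unfolding fact\<Lambda>[OF \<eta>] using poly_factored_poly_eq_0 by blast
      have "dist (cnj (?a l)) (vec_nth lam m) < r"
        unfolding m(2)[symmetric] dist_norm complex_cnj_diff[symmetric] complex_mod_cnj
        using comp[OF \<Lambda>B[OF \<eta>], of l] by (simp add: dist_norm)
      hence "m' = m" using near comp[OF \<Lambda>B[OF \<eta>], of m'] m' by metis
      thus ?thesis using m' m(1) by (metis image_eqI)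
    qed
    \<comment> \<open>An inclusion between finite sets of equal size is an equality, and by
      injectivity of the labelling it is one of multisets.\<close>
    hence sub: "cnj ` ?a ` S \<subseteq> ?a ` S" by auto
    have "card (cnj ` ?a ` S) = card (?a ` S)" by (rule card_image) (auto simp: inj_on_def)
    hence eq: "cnj ` ?a ` S = ?a ` S" by (intro card_subset_eq sub) auto
    have inj': "inj_on ?a S" "inj_on (\<lambda>l. cnj (?a l)) S"
      using Binj[OF \<Lambda>B[OF \<eta>]] by (auto simp: inj_on_def)
    show "image_mset (\<lambda>l. cnj (?a l)) (mset_set S) = image_mset ?a (mset_set S)"
      using inj'[THEN image_mset_mset_set] eq by (simp add: image_image)
  qed
  then obtain F :: "real ^ 'q::{finite,linorder} \<Rightarrow> real ^ 'q::{finite,linorder}"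
    where F: "\<And>\<eta>. \<eta> \<in> U \<Longrightarrow> ma_poly (F \<eta>) = inverted_poly (\<Lambda> \<eta>) S" by metis
  have "local_IR \<theta> lam S U F"
    unfolding local_IR_def using openU \<open>\<theta> \<in> U\<close> cont\<Lambda> \<Lambda>\<theta> fact\<Lambda> F Bnz[OF \<Lambda>B] by blast
  thus ?thesis by blast
qed

section \<open>Differentiability of the profile likelihood\<close>

text \<open>Entrywise, since all sizes share one type. The carrier is fixed at every y, so that
  index ranges in products and determinants do not vary with y.\<close>

definition mat_differentiable ::
  "nat \<Rightarrow> nat \<Rightarrow> ('a::real_normed_vector \<Rightarrow> real mat) \<Rightarrow> 'a \<Rightarrow> bool" where
  "mat_differentiable n m M x \<longleftrightarrow> (\<forall>y. M y \<in> carrier_mat n m) \<and>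
     (\<forall>i<n. \<forall>j<m. (\<lambda>y. M y $$ (i, j)) differentiable (at x))"

lemma differentiable_prod:
  fixes f :: "'i \<Rightarrow> 'a::real_normed_vector \<Rightarrow> real"
  assumes "finite A" "\<And>i. i \<in> A \<Longrightarrow> f i differentiable (at x)"
  shows "(\<lambda>y. \<Prod>i\<in>A. f i y) differentiable (at x)"
  using assms by (induction A rule: finite_induct) (auto intro!: differentiable_mult)

lemma mat_differentiable_const: "A \<in> carrier_mat n m \<Longrightarrow> mat_differentiable n m (\<lambda>_. A) x"
  by (simp add: mat_differentiable_def)

lemma mat_differentiable_mult:
  assumes "mat_differentiable n l M x" "mat_differentiable l m N x"
  shows "mat_differentiable n m (\<lambda>y. M y * N y) x"
proof -
  have "(\<lambda>y. (M y * N y) $$ (i, j)) = (\<lambda>y. \<Sum>h<l. M y $$ (i, h) * N y $$ (h, j))" if "i < n" "j < m" for i j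
  proof
    fix y
    have "M y \<in> carrier_mat n l" "N y \<in> carrier_mat l m" using assms by (auto simp: mat_differentiable_def)
    thus "(M y * N y) $$ (i, j) = (\<Sum>h<l. M y $$ (i, h) * N y $$ (h, j))"
      using that by (simp add: scalar_prod_def atLeast0LessThan)
  qed
  thus ?thesis using assms
    unfolding mat_differentiable_def by (auto intro!: differentiable_sum differentiable_mult mult_carrier_mat[of _ n l])
qed

lemma mat_differentiable_minus:
  assumes "mat_differentiable n m M x" "mat_differentiable n m N x"
  shows "mat_differentiable n m (\<lambda>y. M y - N y) x"
proof -
  have "(\<lambda>y. (M y - N y) $$ (i, j)) = (\<lambda>y. M y $$ (i, j) - N y $$ (i, j))" if "i < n" "j < m" for i j
  proof
    fix y
    have "M y \<in> carrier_mat n m" "N y \<in> carrier_mat n m" using assms by (auto simp: mat_differentiable_def)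
    thus "(M y - N y) $$ (i, j) = M y $$ (i, j) - N y $$ (i, j)" using that by auto
  qed
  thus ?thesis using assms
    unfolding mat_differentiable_def by (auto intro!: differentiable_diff minus_carrier_mat)
qed

lemma mat_differentiable_smult:
  assumes "f differentiable (at x)" "mat_differentiable n m M x"
  shows "mat_differentiable n m (\<lambda>y. f y \<cdot>\<^sub>m M y) x"
proof -
  have "(\<lambda>y. (f y \<cdot>\<^sub>m M y) $$ (i, j)) = (\<lambda>y. f y * M y $$ (i, j))" if "i < n" "j < m" for i j
  proof
    fix y
    have "M y \<in> carrier_mat n m" using assms by (auto simp: mat_differentiable_def)
    thus "(f y \<cdot>\<^sub>m M y) $$ (i, j) = f y * M y $$ (i, j)" using that by auto
  qed
  thus ?thesis using assms
    unfolding mat_differentiable_def by (auto intro!: differentiable_mult)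
qed

lemma differentiable_det:
  assumes "mat_differentiable n n M x"
  shows "(\<lambda>y. det (M y)) differentiable (at x)"
proof -
  have "(\<lambda>y. det (M y)) = (\<lambda>y. \<Sum>p\<in>{p. p permutes {0..<n}}. signof p * (\<Prod>i = 0..<n. M y $$ (i, p i)))"
    using assms by (intro ext det_def') (auto simp: mat_differentiable_def)
  moreover have "(\<lambda>y. M y $$ (i, p i)) differentiable (at x)" if "p permutes {0..<n}" "i < n" for p i
    using that assms permutes_in_image[OF that(1), of i] by (auto simp: mat_differentiable_def)
  ultimately show ?thesis
    by (auto intro!: differentiable_sum differentiable_mult differentiable_prod finite_permutations)
qed

text \<open>By the adjugate formula; a determinant that is nonzero at every y makes the formula an
  identity of functions.\<close>

lemma mat_differentiable_inv_mat:
  assumes M: "mat_differentiable n n M x" and d: "\<And>y. det (M y) \<noteq> 0"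
  shows "mat_differentiable n n (\<lambda>y. inv_mat (M y)) x"
proof -
  have Mc: "M y \<in> carrier_mat n n" for y using M by (auto simp: mat_differentiable_def)
  have "mat_differentiable n n (\<lambda>y. adj_mat (M y)) x"
    unfolding mat_differentiable_def
  proof (intro conjI allI impI)
    show "adj_mat (M y) \<in> carrier_mat n n" for y by (rule adj_mat(1)[OF Mc])
    fix i j assume ij: "i < n" "j < n"
    have "mat_differentiable (n - 1) (n - 1) (\<lambda>y. mat_delete (M y) j i) x"
      using M carrier_matD[OF Mc] unfolding mat_differentiable_def by (auto simp: mat_delete_def)
    hence "(\<lambda>y. (-1) ^ (j + i) * det (mat_delete (M y) j i)) differentiable (at x)"
      by (intro differentiable_mult differentiable_const differentiable_det)
    moreover have "adj_mat (M y) $$ (i, j) = (-1) ^ (j + i) * det (mat_delete (M y) j i)" for y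
      using ij carrier_matD[OF Mc[of y]] by (simp add: adj_mat_def cofactor_def)
    ultimately show "(\<lambda>y. adj_mat (M y) $$ (i, j)) differentiable (at x)" by simp
  qed
  hence "mat_differentiable n n (\<lambda>y. inverse (det (M y)) \<cdot>\<^sub>m adj_mat (M y)) x"
    using d differentiable_det[OF M] by (intro mat_differentiable_smult differentiable_inverse) auto
  thus ?thesis using inv_mat_eq_adj[OF Mc d] by simp
qed

text \<open>\<open>ln\<close> is even on the reals (\<open>ln_minus\<close>), so at a negative value
  f is replaced by - f.\<close>

lemma differentiable_ln:
  fixes f :: "'a::real_normed_vector \<Rightarrow> real"
  assumes f: "f differentiable (at x)" and nz: "f x \<noteq> 0"
  shows "(\<lambda>y. ln (f y)) differentiable (at x)"
proof -
  have pos: "(\<lambda>y. ln (g y)) differentiable (at x)" if "g differentiable (at x)" "g x > 0" for g :: "'a \<Rightarrow> real"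
    using that has_derivative_ln unfolding differentiable_def by blast
  show ?thesis
  proof (cases "f x > 0")
    case False
    hence "(\<lambda>y. ln (- f y)) differentiable (at x)" using f nz by (intro pos differentiable_minus) auto
    thus ?thesis by (simp add: ln_minus)
  qed (use pos f in auto)
qed

lemma differentiable_acov: "(\<lambda>\<theta> :: real ^ 'q::{finite,linorder}. acov \<theta> l) differentiable (at x)"
proof -
  have "(\<lambda>\<theta> :: real ^ 'q::{finite,linorder}. ma_coeff \<theta> i) differentiable (at x)" for i
    unfolding ma_coeff_def
    by (cases "i = 0"; cases "i \<le> CARD('q)")
      (simp_all add: bounded_linear_imp_differentiable[OF bounded_linear_vec_nth])
  thus ?thesis unfolding acov_def
    by (cases "nat \<bar>l\<bar> \<le> CARD('q)") (simp_all add: differentiable_mult)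
qed

context
  fixes T k p :: nat and X :: "nat \<Rightarrow> real vec" and \<theta> :: "real ^ 'q::{finite,linorder}"
  assumes T: "CARD('q) \<le> T"
    and full_rank: "vec_space.rank T (X_lag T k p X) = 1 + p * k"
begin

text \<open>In Toeplitz form the entries are quadratic polynomials in the coefficients, and no
  inverse of \<open>Theta\<close> has to be differentiated.\<close>

lemma mat_differentiable_Sigma: "mat_differentiable T T (Sigma_mat T) \<theta>"
  unfolding mat_differentiable_def Sigma_mat_toeplitz[OF T] by (simp add: differentiable_acov)

lemma mat_differentiable_Omega_opt: "mat_differentiable k k (Omega_opt T k p X) \<theta>"
proof -
  have P: "mat_differentiable T T (prec_mat T) \<theta>"
    by (rule mat_differentiable_inv_mat[OF mat_differentiable_Sigma positive_definite_det[OF Sigma_mat_pd[OF T]]])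
  have c: "mat_differentiable a b (\<lambda>\<theta>. A\<^sup>T * prec_mat T \<theta> * B) \<theta>" if "A \<in> carrier_mat T a" "B \<in> carrier_mat T b" for A B a b
    using that by (intro mat_differentiable_mult[where l = T] mat_differentiable_const P) auto
  have G: "mat_differentiable (1 + p * k) (1 + p * k) (\<lambda>\<theta>. inv_mat ((X_lag T k p X)\<^sup>T * prec_mat T \<theta> * X_lag T k p X)) \<theta>"
    by (rule mat_differentiable_inv_mat[OF c[OF X_lag_carrier X_lag_carrier] positive_definite_det[OF Gram_pd[OF T full_rank]]])
  show ?thesis
    unfolding Omega_opt_eq[OF T full_rank, abs_def]
    by (intro mat_differentiable_smult mat_differentiable_minus differentiable_const
        mat_differentiable_mult[where l = "1 + p * k"] c G lagged_carrier X_lag_carrier)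
qed

lemma profile_log_lik_differentiable:
  assumes "det (Omega_opt T k p X \<theta>) \<noteq> 0"
  shows "profile_log_lik T k p X differentiable (at \<theta>)"
proof -
  have "(\<lambda>\<theta>. ln (det (Omega_opt T k p X \<theta>))) differentiable (at \<theta>)"
    by (rule differentiable_ln[OF differentiable_det[OF mat_differentiable_Omega_opt] assms])
  moreover have "(\<lambda>\<theta>. ln (det (Sigma_mat T \<theta>))) differentiable (at \<theta>)"
    by (rule differentiable_ln[OF differentiable_det[OF mat_differentiable_Sigma] positive_definite_det[OF Sigma_mat_pd[OF T]]])
  ultimately show ?thesis
    unfolding profile_log_lik_def[abs_def] det_Sigma_mat[OF T, symmetric]
    by (intro differentiable_diff differentiable_mult differentiable_const)
qed

end

section \<open>Gradients and the chain rule\<close>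

lemma differentiable_imp_GDERIV:
  fixes f :: "'a::euclidean_space \<Rightarrow> real"
  assumes "f differentiable (at x)"
  shows "\<exists>D. GDERIV f x :> D"
proof -
  obtain f' where f': "(f has_derivative f') (at x)" using assms unfolding differentiable_def by blast
  \<comment> \<open>The gradient is the Riesz vector of the derivative, that is, its adjoint applied
    to 1.\<close>
  have "f' = (\<lambda>h. inner h (adjoint f' 1))"
    using adjoint_works[OF has_derivative_linear[OF f'], of _ 1] by (simp add: fun_eq_iff)
  thus ?thesis using f' unfolding gderiv_def by metis
qed

text \<open>Both sides represent the derivative of h at x, which is unique.
  \<open>dot_lmul_matrix\<close> moves the Jacobian to the gradient and produces the row-vector
  form.\<close>

lemma GDERIV_compose_jacobian:
  fixes f :: "real ^ 'n \<Rightarrow> real" and F :: "real ^ 'm \<Rightarrow> real ^ 'n"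
  assumes f: "GDERIV f (F x) :> D'" and F: "F differentiable (at x)"
    and h: "GDERIV h x :> D" and U: "open U" "x \<in> U" and eq: "\<And>y. y \<in> U \<Longrightarrow> f (F y) = h y"
  shows "D = D' v* jacobian F (at x)"
proof -
  have "((\<lambda>y. f (F y)) has_derivative (\<lambda>h. inner (jacobian F (at x) *v h) D')) (at x)"
    using has_derivative_compose[of F _ x UNIV f] F f unfolding jacobian_works gderiv_def by blast
  hence "(h has_derivative (\<lambda>h. inner (jacobian F (at x) *v h) D')) (at x)"
    by (rule has_derivative_transform_within_open[OF _ U]) (rule eq)
  hence "(\<lambda>h. inner (jacobian F (at x) *v h) D') = (\<lambda>h. inner h D)"
    using h unfolding gderiv_def by (rule has_derivative_unique)
  hence "inner v D = inner v (D' v* jacobian F (at x))" for v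
    using dot_lmul_matrix[of D' "jacobian F (at x)" v] by (simp add: inner_commute fun_eq_iff)
  thus ?thesis using vector_eq_ldot by blast
qed

lemma local_IR_chain_rule:
  fixes \<theta> :: "real ^ 'q::{finite,linorder}" and lam :: "complex ^ 'q::{finite,linorder}"
  assumes T: "CARD('q) \<le> T" and full_rank: "vec_space.rank T (X_lag T k p X) = 1 + p * k"
    and d: "det (Omega_opt T k p X \<theta>) \<noteq> 0"
    and inj: "inj (vec_nth lam)" and IR: "local_IR \<theta> lam S U F"
  shows "\<exists>D D'. GDERIV (profile_log_lik T k p X) \<theta> :> D \<and>
    GDERIV (profile_log_lik T k p X) (F \<theta>) :> D' \<and> D = D' v* jacobian F (at \<theta>)"
proof -
  let ?d = "\<lambda>\<eta> :: real ^ 'q::{finite,linorder}. det (Omega_opt T k p X \<eta>)"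
  obtain \<Lambda> where U: "open U" "\<theta> \<in> U"
    and \<Lambda>: "\<And>\<eta>. \<eta> \<in> U \<Longrightarrow> \<forall>l. vec_nth (\<Lambda> \<eta>) l \<noteq> 0" "\<And>\<eta>. \<eta> \<in> U \<Longrightarrow> ma_poly \<eta> = factored_poly (\<Lambda> \<eta>)"
      "\<And>\<eta>. \<eta> \<in> U \<Longrightarrow> ma_poly (F \<eta>) = inverted_poly (\<Lambda> \<eta>) S"
    using IR unfolding local_IR_def by metis
  have scaled: "\<exists>s>0. Sigma_mat T (F \<eta>) = inverse s \<cdot>\<^sub>m Sigma_mat T \<eta>" if "\<eta> \<in> U" for \<eta>
    using acov_inverted[OF \<Lambda>[OF that]] Sigma_mat_scaled[OF T] by metis
  \<comment> \<open>Equality of the profile likelihoods is available where the determinant of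
    \<open>Omega_opt\<close> is nonzero; by continuity this persists near \<theta>, so U is cut down
    to that open set.\<close>
  have "continuous_on UNIV ?d"
    using differentiable_det[OF mat_differentiable_Omega_opt[OF T full_rank]]
    by (simp add: continuous_on_eq_continuous_at differentiable_imp_continuous_within)
  hence "open (?d -` (- {0}))" by (intro open_vimage) auto
  hence V: "open (U \<inter> ?d -` (- {0}))" "\<theta> \<in> U \<inter> ?d -` (- {0})" using U d by auto
  have eq: "profile_log_lik T k p X (F \<eta>) = profile_log_lik T k p X \<eta>" if "\<eta> \<in> U \<inter> ?d -` (- {0})" for \<eta>
    using scaled[of \<eta>] that profile_log_lik_scaled[OF T full_rank] by auto
  obtain s where s: "s > 0" "Sigma_mat T (F \<theta>) = inverse s \<cdot>\<^sub>m Sigma_mat T \<theta>"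
    using scaled[OF U(2)] by blast
  \<comment> \<open>Nonvanishing carries over to the image point by scaling, so the gradient exists
    there too.\<close>
  have "det (Omega_opt T k p X (F \<theta>)) \<noteq> 0"
    unfolding Omega_opt_scaled[OF T full_rank s] using d s by simp
  then obtain D' where D': "GDERIV (profile_log_lik T k p X) (F \<theta>) :> D'"
    using differentiable_imp_GDERIV profile_log_lik_differentiable[OF T full_rank] by blast
  obtain D where D: "GDERIV (profile_log_lik T k p X) \<theta> :> D"
    using differentiable_imp_GDERIV profile_log_lik_differentiable[OF T full_rank d] by blast
  show ?thesis
    using D D' GDERIV_compose_jacobian[OF D' local_IR_differentiable[OF IR inj] D V eq] by blast
qed

theorem theorem3:
  fixes k p T :: nat
    and \<theta> :: "real ^ 'q::{finite,linorder}"
    and lam :: "complex ^ 'q::{finite,linorder}"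
    and S :: "'q set"
    and \<Omega> :: "real mat"
    and X :: "nat \<Rightarrow> real vec"
  assumes k: "k \<ge> 1"
    and T: "T \<ge> CARD('q)"
    and factorization: "ma_poly \<theta> = factored_poly lam"
    and lam_nonzero: "\<forall>l. vec_nth lam l \<noteq> 0"
    and conj_closed: "image_mset (\<lambda>l. cnj (vec_nth lam l)) (mset_set S)
                      = image_mset (\<lambda>l. vec_nth lam l) (mset_set S)"
    and Omega: "positive_definite k \<Omega>"
    and data: "\<forall>n\<in>{1..T + p}. X n \<in> carrier_vec k"
    and full_rank: "vec_space.rank T (X_lag T k p X) = 1 + p * k"
  shows "\<exists>(c :: real) (\<theta>_IR :: real ^ 'q::{finite,linorder}).
     complex_of_real c = (\<Prod>l\<in>S. vec_nth lam l) \<and>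
     ma_poly \<theta>_IR = inverted_poly lam S \<and>
     (\<forall>z. z \<noteq> 0 \<longrightarrow> acov_gf z \<theta>_IR (c\<^sup>2 \<cdot>\<^sub>m \<Omega>) = acov_gf z \<theta> \<Omega>) \<and>
     Sigma_mat T \<theta>_IR = inverse (c\<^sup>2) \<cdot>\<^sub>m Sigma_mat T \<theta> \<and>
     det (Kbar T \<theta>_IR) = inverse (c ^ (2 * T)) * det (Kbar T \<theta>) \<and>
     mu_Phi_opt T k p X \<theta>_IR = mu_Phi_opt T k p X \<theta> \<and>
     Omega_opt T k p X \<theta>_IR = c\<^sup>2 \<cdot>\<^sub>m Omega_opt T k p X \<theta> \<and>
     (\<forall>\<mu> \<in> carrier_mat 1 k. \<forall>\<Phi>. (\<forall>i\<in>{1..p}. \<Phi> i \<in> carrier_mat k k) \<longrightarrow>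
        log_lik T k p X \<theta>_IR \<mu> \<Phi> (c\<^sup>2 \<cdot>\<^sub>m \<Omega>) = log_lik T k p X \<theta> \<mu> \<Phi> \<Omega>) \<and>
     (positive_definite k (Omega_opt T k p X \<theta>) \<longrightarrow>
        profile_log_lik T k p X \<theta>_IR = profile_log_lik T k p X \<theta> \<and>
        (inj (\<lambda>l. vec_nth lam l) \<longrightarrow>
           (\<exists>U F. local_IR \<theta> lam S U F) \<and>
           (\<forall>U F. local_IR \<theta> lam S U F \<longrightarrow>
              F differentiable (at \<theta>) \<and>
              (\<exists>D D_IR.
                 GDERIV (profile_log_lik T k p X) \<theta> :> D \<and>
                 GDERIV (profile_log_lik T k p X) \<theta>_IR :> D_IR \<and>
                 D = D_IR v* jacobian F (at \<theta>)))))"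
proof -
  have conj_closed': "image_mset (\<lambda>l. cnj (vec_nth lam l)) (mset_set S) = image_mset (vec_nth lam) (mset_set S)"
    using conj_closed by simp
  \<comment> \<open>Conjugation permutes the factors, so the product is real and c exists.\<close>
  have "cnj (\<Prod>l\<in>S. vec_nth lam l) = (\<Prod>l\<in>S. cnj (vec_nth lam l))" by simp
  also have "\<dots> = (\<Prod>l\<in>S. vec_nth lam l)"
    using arg_cong[OF conj_closed', of prod_mset] by (simp only: prod_unfold_prod_mset)
  finally have "(\<Prod>l\<in>S. vec_nth lam l) \<in> \<real>" by (simp only: Reals_cnj_iff)
  then obtain c :: real where c: "complex_of_real c = (\<Prod>l\<in>S. vec_nth lam l)"
    by (auto elim: Reals_cases)
  obtain \<theta>_IR :: "real ^ 'q::{finite,linorder}" where IR: "ma_poly \<theta>_IR = inverted_poly lam S"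
    using inverted_poly_real[OF factorization conj_closed'] by blast
  obtain s where s: "s > 0" "complex_of_real s = (\<Prod>l\<in>S. vec_nth lam l)\<^sup>2" "\<And>l. acov \<theta> l = s * acov \<theta>_IR l"
    using acov_inverted[OF lam_nonzero factorization IR] by blast
  have "complex_of_real s = complex_of_real (c\<^sup>2)" using s(2) c by simp
  hence sc: "s = c\<^sup>2" by (simp only: of_real_eq_iff)
  note s = s[unfolded sc]
  note \<Sigma> = Sigma_mat_scaled[OF T s(1,3)]
  note scaled = T full_rank s(1) \<Sigma>
  have gf: "acov_gf z \<theta>_IR (c\<^sup>2 \<cdot>\<^sub>m \<Omega>) = acov_gf z \<theta> \<Omega>" for z
    by (rule acov_gf_scaled[OF s(3)])
  have Kbar: "det (Kbar T \<theta>_IR) = inverse (c ^ (2 * T)) * det (Kbar T \<theta>)"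
    using det_Kbar_scaled[OF scaled] by (simp add: power_mult)
  have profile: "profile_log_lik T k p X \<theta>_IR = profile_log_lik T k p X \<theta>"
    if "positive_definite k (Omega_opt T k p X \<theta>)"
    by (rule profile_log_lik_scaled[OF scaled positive_definite_det[OF that]])
  have IR_chain: "F differentiable (at \<theta>) \<and> (\<exists>D D_IR. GDERIV (profile_log_lik T k p X) \<theta> :> D \<and>
      GDERIV (profile_log_lik T k p X) \<theta>_IR :> D_IR \<and> D = D_IR v* jacobian F (at \<theta>))"
    if "positive_definite k (Omega_opt T k p X \<theta>)" "inj (vec_nth lam)" "local_IR \<theta> lam S U F" for U F
  proof -
    \<comment> \<open>Every local version of IR starts from the given roots at \<theta>, so its
      value there is determined by its polynomial.\<close>
    have "ma_poly (F \<theta>) = inverted_poly lam S"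
      using that(3) unfolding local_IR_def by metis
    hence "F \<theta> = \<theta>_IR" using IR by (intro ma_poly_inj) simp
    thus ?thesis
      using local_IR_chain_rule[OF T full_rank positive_definite_det[OF that(1)] that(2,3)]
        local_IR_differentiable[OF that(3,2)] by simp
  qed
  show ?thesis
    using c IR gf \<Sigma> Kbar mu_Phi_opt_scaled[OF scaled] Omega_opt_scaled[OF scaled]
      log_lik_scaled[OF scaled Omega] profile IR_chain
      local_IR_exists[OF factorization lam_nonzero conj_closed']
    by (intro exI[of _ c] exI[of _ \<theta>_IR]) simp
qed

end
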